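(* If $\psi:\mathfrak{sv}^+\to\mathbb{C}$ is identically zero and $\xi\in\mathbb{C}$, $\xi\neq0$, then the set of Whittaker vectors of $L_{\psi,\xi}$ (that is, of $v\in L_{\psi,\xi}$ with $xv=\psi(x)v=0$ for all $x\in\mathfrak{sv}^+$) is $\mathbb{C}[L_0]\bar w$, where $\bar w=\overline{1\otimes 1}$.
   Context: The Schrödinger-Virasoro algebra $\mathfrak{sv}$ is the complex Lie algebra with basis $\{L_n,M_n,Y_{n+\frac12}\mid n\in\mathbb{Z}\}$ and brackets, for $m,n\in\mathbb{Z}$: $[L_m,L_n]=(n-m)L_{m+n}$, $[L_m,M_n]=nM_{m+n}$, $[L_m,Y_{n+\frac12}]=(n+\frac{1-m}{2})Y_{m+n+\frac12}$, $[Y_{m+\frac12},Y_{n+\frac12}]=(n-m)M_{m+n+1}$, $[M_m,M_n]=[M_m,Y_{n+\frac12}]=0$. The element $M_0$ is central. Put $\mathfrak{sv}^+=\mathrm{span}_{\mathbb{C}}\{L_n,M_n,Y_{m+\frac12}\mid n\geq 1,\ m\geq 0\}$. For a Lie algebra homomorphism $\psi:\mathfrak{sv}^+\to\mathbb{C}$ let $\mathbb{C}_\psi$ be the one-dimensional $\mathfrak{sv}^+$-module with $x\alpha=\psi(x)\alpha$, let $W_\psi=U(\mathfrak{sv})\otimes_{U(\mathfrak{sv}^+)}\mathbb{C}_\psi$, and for $\xi\in\mathbb{C}$ let $L_{\psi,\xi}=W_\psi/(M_0-\xi)W_\psi$; $\overline{1\otimes1}$ denotes the image of $1\otimes1$.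 $\mathbb{C}[L_0]$ is the polynomial subalgebra of $U(\mathfrak{sv})$ generated by $L_0$. *)

theory Defs
  imports Complex_Main "HOL.Hull" "HOL-Library.Poly_Mapping" "HOL-Library.Set_Algebras"
begin

section \<open>Complex vector spaces, algebras and Lie algebras\<close>

class complex_vector = ab_group_add +
  fixes scaleC :: "complex \<Rightarrow> 'a \<Rightarrow> 'a"  (infixr \<open>*\<^sub>C\<close> 75)
  assumes scaleC_add_right: "c *\<^sub>C (x + y) = c *\<^sub>C x + c *\<^sub>C y"
    and scaleC_add_left: "(c + d) *\<^sub>C x = c *\<^sub>C x + d *\<^sub>C x"
    and scaleC_scaleC [simp]: "c *\<^sub>C d *\<^sub>C x = (c * d) *\<^sub>C x"
    and scaleC_one [simp]: "1 *\<^sub>C x = x"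

interpretation complex_vector:
    vector_space "scaleC :: complex \<Rightarrow> 'a \<Rightarrow> 'a::complex_vector"
  by unfold_locales (simp_all add: scaleC_add_right scaleC_add_left)

lemma linear_scaleCI:
  fixes f :: "'a::complex_vector \<Rightarrow> 'b::complex_vector"
  assumes "\<And>x y. f (x + y) = f x + f y" and "\<And>c x. f (c *\<^sub>C x) = c *\<^sub>C f x"
  shows "Vector_Spaces.linear scaleC scaleC f"
  by (simp add: assms Vector_Spaces.linear_iff complex_vector.vector_space_axioms)

class complex_algebra_1 = complex_vector + ring_1 +
  assumes mult_scaleC_left [simp]: "(c *\<^sub>C x) * y = c *\<^sub>C (x * y)"
    and mult_scaleC_right [simp]: "x * (c *\<^sub>C y) = c *\<^sub>C (x * y)"

class complex_lie_algebra = complex_vector +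
  fixes lie_bracket :: "'a \<Rightarrow> 'a \<Rightarrow> 'a"
  assumes lie_bracket_add_left: "lie_bracket (x + y) z = lie_bracket x z + lie_bracket y z"
    and lie_bracket_add_right: "lie_bracket x (y + z) = lie_bracket x y + lie_bracket x z"
    and lie_bracket_scaleC_left: "lie_bracket (c *\<^sub>C x) y = c *\<^sub>C lie_bracket x y"
    and lie_bracket_scaleC_right: "lie_bracket x (c *\<^sub>C y) = c *\<^sub>C lie_bracket x y"
    and lie_bracket_self: "lie_bracket x x = 0"
    and lie_jacobi: "lie_bracket x (lie_bracket y z) + lie_bracket y (lie_bracket z x)
                       + lie_bracket z (lie_bracket x y) = 0"

definition lie_hom :: "('g::complex_lie_algebra \<Rightarrow> 'h::complex_lie_algebra) \<Rightarrow> bool" where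
  "lie_hom f \<longleftrightarrow> Vector_Spaces.linear scaleC scaleC f \<and>
     (\<forall>x y. f (lie_bracket x y) = lie_bracket (f x) (f y))"

text \<open>Lie algebra homomorphisms into the commutator Lie algebra of an associative algebra.\<close>

definition lie_hom_commutator :: "('g::complex_lie_algebra \<Rightarrow> 'a::complex_algebra_1) \<Rightarrow> bool" where
  "lie_hom_commutator f \<longleftrightarrow> Vector_Spaces.linear scaleC scaleC f \<and>
     (\<forall>x y. f (lie_bracket x y) = f x * f y - f y * f x)"

instantiation complex :: "{complex_algebra_1, complex_lie_algebra}"
begin

definition scaleC_complex :: "complex \<Rightarrow> complex \<Rightarrow> complex" where
  "scaleC_complex c x = c * x"

text \<open>The one-dimensional abelian Lie algebra.\<close>

definition lie_bracket_complex :: "complex \<Rightarrow> complex \<Rightarrow> complex" where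
  "lie_bracket_complex x y = 0"

instance
  by standard (simp_all add: scaleC_complex_def lie_bracket_complex_def algebra_simps)

end


section \<open>Finitely supported functions\<close>

instantiation poly_mapping :: (type, complex_vector) complex_vector
begin

lift_definition scaleC_poly_mapping :: "complex \<Rightarrow> ('a \<Rightarrow>\<^sub>0 'b) \<Rightarrow> ('a \<Rightarrow>\<^sub>0 'b)"
  is "\<lambda>c f k. c *\<^sub>C f k"
  by (rule finite_subset [rotated]) auto

instance
  by standard (transfer; simp add: scaleC_add_right scaleC_add_left fun_eq_iff)+

end

lemma lookup_scaleC [simp]: "Poly_Mapping.lookup (c *\<^sub>C p) k = c *\<^sub>C Poly_Mapping.lookup p k"
  by transfer simp

lemma scaleC_single [simp]: "c *\<^sub>C Poly_Mapping.single k a = Poly_Mapping.single k (c *\<^sub>C a)"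
  by (rule poly_mapping_eqI) (simp add: lookup_single when_def)

lemma poly_mapping_linear_induct [case_names zero add single]:
  fixes p :: "'k \<Rightarrow>\<^sub>0 complex"
  assumes "P 0" and "\<And>p q. P p \<Longrightarrow> P q \<Longrightarrow> P (p + q)"
    and "\<And>c k. P (c *\<^sub>C Poly_Mapping.single k 1)"
  shows "P p"
proof (induction p rule: update_induct)
  case const
  show ?case using assms(1) by simp
next
  case (update p k c)
  have "Poly_Mapping.update k c p = p + c *\<^sub>C Poly_Mapping.single k 1"
    using update(1)
    by (intro poly_mapping_eqI)
      (auto simp: lookup_update lookup_add lookup_single when_def scaleC_complex_def in_keys_iff)
  then show ?case using update assms by simp
qed

definition lin_ext :: "('k \<Rightarrow> 'a::complex_vector) \<Rightarrow> ('k \<Rightarrow>\<^sub>0 complex) \<Rightarrow> 'a" where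
  "lin_ext f p = (\<Sum>k\<in>Poly_Mapping.keys p. Poly_Mapping.lookup p k *\<^sub>C f k)"

lemma lin_ext_superset:
  assumes "finite S" "Poly_Mapping.keys p \<subseteq> S"
  shows "lin_ext f p = (\<Sum>k\<in>S. Poly_Mapping.lookup p k *\<^sub>C f k)"
  unfolding lin_ext_def using assms
  by (intro sum.mono_neutral_left) (auto simp: in_keys_iff)

lemma lin_ext_zero [simp]: "lin_ext f 0 = 0"
  by (simp add: lin_ext_def)

lemma lin_ext_add: "lin_ext f (p + q) = lin_ext f p + lin_ext f q"
  using Poly_Mapping.keys_add [of p q]
  by (simp add: lin_ext_superset [of "Poly_Mapping.keys p \<union> Poly_Mapping.keys q"]
      lookup_add scaleC_add_left sum.distrib)

lemma lin_ext_scaleC: "lin_ext f (c *\<^sub>C p) = c *\<^sub>C lin_ext f p"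
proof -
  have "Poly_Mapping.keys (c *\<^sub>C p) \<subseteq> Poly_Mapping.keys p"
    by (auto simp: in_keys_iff)
  then show ?thesis
    by (simp add: lin_ext_superset [of "Poly_Mapping.keys p"] complex_vector.scale_sum_right
        scaleC_complex_def)
qed

lemma lin_ext_single [simp]: "lin_ext f (Poly_Mapping.single k c) = c *\<^sub>C f k"
  by (simp add: lin_ext_def)

lemma lin_ext_uminus: "lin_ext f (- p) = - lin_ext f p"
proof -
  have "lin_ext f p + lin_ext f (- p) = 0"
    by (simp flip: lin_ext_add)
  then show ?thesis by (rule minus_unique [symmetric])
qed

lemma lin_ext_diff: "lin_ext f (p - q) = lin_ext f p - lin_ext f q"
  using lin_ext_add [of f p "- q"] by (simp add: lin_ext_uminus)

lemma lin_ext_fun_add: "lin_ext (\<lambda>k. f k + g k) p = lin_ext f p + lin_ext g p"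
  by (simp add: lin_ext_def scaleC_add_right sum.distrib)

lemma lin_ext_fun_scaleC: "lin_ext (\<lambda>k. c *\<^sub>C f k) p = c *\<^sub>C lin_ext f p"
  unfolding lin_ext_def complex_vector.scale_sum_right
  by (rule sum.cong) (simp_all only: scaleC_scaleC mult.commute)


section \<open>Universal enveloping algebras\<close>

text \<open>
  Words form the free monoid, written additively so that \<open>'a word \<Rightarrow>\<^sub>0 complex\<close>, with the
  convolution product of the library, is the free associative unital algebra on \<open>'a\<close>.
\<close>

datatype 'a word = Word (letters: "'a list")

instantiation word :: (type) monoid_add
begin

definition zero_word :: "'a word" where
  "zero_word = Word []"

definition plus_word :: "'a word \<Rightarrow> 'a word \<Rightarrow> 'a word" where
  "plus_word v w = Word (letters v @ letters w)"

instance
  by standard (simp_all add: zero_word_def plus_word_def)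

end

instance poly_mapping :: (monoid_add, complex_algebra_1) complex_algebra_1
proof
  fix c :: complex and p q :: "'a \<Rightarrow>\<^sub>0 'b"
  have l: "c *\<^sub>C r = Poly_Mapping.single 0 (c *\<^sub>C 1) * r" for r :: "'a \<Rightarrow>\<^sub>0 'b"
  proof (rule poly_mapping_eqI)
    fix k
    have "Poly_Mapping.single 0 (c *\<^sub>C 1) * r = Poly_Mapping.map ((*) (c *\<^sub>C 1)) r"
      by (simp add: mult_map_scale_conv_mult)
    then show "Poly_Mapping.lookup (c *\<^sub>C r) k = Poly_Mapping.lookup (Poly_Mapping.single 0 (c *\<^sub>C 1) * r) k"
      by (simp add: Poly_Mapping.map.rep_eq when_def)
  qed
  show 1: "(c *\<^sub>C p) * q = c *\<^sub>C (p * q)"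
    by (simp add: l [of p] l [of "p * q"] mult.assoc)
  show "p * (c *\<^sub>C q) = c *\<^sub>C (p * q)"
  proof -
    have "r * Poly_Mapping.single 0 (c *\<^sub>C 1) = Poly_Mapping.single 0 (c *\<^sub>C 1) * r"
      for r :: "'a \<Rightarrow>\<^sub>0 'b"
    proof (induction r rule: update_induct)
      case const
      show ?case by simp
    next
      case (update r k b)
      have "Poly_Mapping.update k b r = r + Poly_Mapping.single k b"
        using update(1)
        by (intro poly_mapping_eqI)
          (auto simp: lookup_update lookup_add lookup_single when_def in_keys_iff)
      then show ?case
        using update.IH by (simp add: distrib_left distrib_right mult_single)
    qed
    then show ?thesis
      by (metis l mult.assoc)
  qed
qed

definition free_gen :: "'a \<Rightarrow> ('a word \<Rightarrow>\<^sub>0 complex)" where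
  "free_gen x = Poly_Mapping.single (Word [x]) 1"

definition free_eval :: "('a \<Rightarrow> 'b::complex_algebra_1) \<Rightarrow> ('a word \<Rightarrow>\<^sub>0 complex) \<Rightarrow> 'b" where
  "free_eval f = lin_ext (\<lambda>w. prod_list (map f (letters w)))"

lemma free_eval_add: "free_eval f (p + q) = free_eval f p + free_eval f q"
  and free_eval_diff: "free_eval f (p - q) = free_eval f p - free_eval f q"
  and free_eval_scaleC: "free_eval f (c *\<^sub>C p) = c *\<^sub>C free_eval f p"
  by (simp_all add: free_eval_def lin_ext_add lin_ext_diff lin_ext_scaleC)

lemma free_eval_zero [simp]: "free_eval f 0 = 0"
  by (simp add: free_eval_def)

lemma free_eval_one [simp]: "free_eval f 1 = 1"
  unfolding single_one [symmetric] by (simp add: free_eval_def zero_word_def del: single_one)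

lemma free_eval_gen [simp]: "free_eval f (free_gen x) = f x"
  by (simp add: free_eval_def free_gen_def)

lemma free_eval_mult: "free_eval f (p * q) = free_eval f p * free_eval f q"
proof (induction p rule: poly_mapping_linear_induct)
  case (single c v)
  show ?case
  proof (induction q rule: poly_mapping_linear_induct)
    case (single d w)
    show ?case
      by (simp add: mult_single free_eval_def plus_word_def scaleC_complex_def mult.commute)
  qed (simp_all add: distrib_left free_eval_add)
qed (simp_all add: distrib_right free_eval_add)

definition two_sided_ideal :: "'a::ring_1 set \<Rightarrow> bool" where
  "two_sided_ideal I \<longleftrightarrow> 0 \<in> I \<and> (\<forall>x\<in>I. \<forall>y\<in>I. x + y \<in> I) \<and>
     (\<forall>a. \<forall>x\<in>I. a * x \<in> I \<and> x * a \<in> I)"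

lemma two_sided_ideal_hull: "two_sided_ideal (two_sided_ideal hull S)"
  by (rule hull_in) (auto simp: two_sided_ideal_def)

text \<open>
  The first two families of relators make the generators depend linearly on the element of
  the Lie algebra (so the quotient by them is the tensor algebra); the third one identifies
  commutators with brackets.
\<close>

definition uea_relators :: "('g::complex_lie_algebra word \<Rightarrow>\<^sub>0 complex) set" where
  "uea_relators =
     {free_gen (x + y) - free_gen x - free_gen y | x y. True} \<union>
     {free_gen (c *\<^sub>C x) - c *\<^sub>C free_gen x | c x. True} \<union>
     {free_gen x * free_gen y - free_gen y * free_gen x - free_gen (lie_bracket x y) | x y. True}"

definition uea_ideal :: "('g::complex_lie_algebra word \<Rightarrow>\<^sub>0 complex) set" where
  "uea_ideal = two_sided_ideal hull uea_relators"

lemma uea_ideal_zero: "0 \<in> uea_ideal"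
  and uea_ideal_add: "p \<in> uea_ideal \<Longrightarrow> q \<in> uea_ideal \<Longrightarrow> p + q \<in> uea_ideal"
  and uea_ideal_mult_left: "p \<in> uea_ideal \<Longrightarrow> r * p \<in> uea_ideal"
  and uea_ideal_mult_right: "p \<in> uea_ideal \<Longrightarrow> p * r \<in> uea_ideal"
  using two_sided_ideal_hull [of uea_relators]
  unfolding uea_ideal_def [symmetric] two_sided_ideal_def by blast+

lemma uea_ideal_scaleC: "p \<in> uea_ideal \<Longrightarrow> c *\<^sub>C p \<in> uea_ideal"
  using uea_ideal_mult_left [of p "c *\<^sub>C 1"] by simp

lemma uea_ideal_uminus: "p \<in> uea_ideal \<Longrightarrow> - p \<in> uea_ideal"
  using uea_ideal_mult_left [of p "- 1"] by simp

lemma free_eval_uea_ideal: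
  assumes "lie_hom_commutator f" "p \<in> uea_ideal"
  shows "free_eval f p = 0"
proof -
  interpret f: Vector_Spaces.linear scaleC scaleC f
    using assms(1) by (simp add: lie_hom_commutator_def)
  show ?thesis
    using assms(2) unfolding uea_ideal_def
  proof (rule hull_induct)
    fix r :: "'a word \<Rightarrow>\<^sub>0 complex"
    assume "r \<in> uea_relators"
    then show "free_eval f r = 0"
      using assms(1)
      by (auto simp: uea_relators_def lie_hom_commutator_def free_eval_diff free_eval_scaleC
          free_eval_mult f.add f.scale)
  qed (auto simp: two_sided_ideal_def free_eval_add free_eval_mult)
qed

quotient_type (overloaded) 'g uea =
  "'g::complex_lie_algebra word \<Rightarrow>\<^sub>0 complex" / "\<lambda>p q. p - q \<in> uea_ideal"
proof (rule equivpI)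
  show "reflp (\<lambda>p q::'g word \<Rightarrow>\<^sub>0 complex. p - q \<in> uea_ideal)"
    by (simp add: reflp_def uea_ideal_zero)
  show "symp (\<lambda>p q::'g word \<Rightarrow>\<^sub>0 complex. p - q \<in> uea_ideal)"
    by (metis (mono_tags) minus_diff_eq sympI uea_ideal_uminus)
  show "transp (\<lambda>p q::'g word \<Rightarrow>\<^sub>0 complex. p - q \<in> uea_ideal)"
    by (rule transpI) (drule (1) uea_ideal_add, simp)
qed

lemma uea_zero_neq_one: "(0 :: 'g::complex_lie_algebra word \<Rightarrow>\<^sub>0 complex) - 1 \<notin> uea_ideal"
proof
  assume *: "(0 :: 'g word \<Rightarrow>\<^sub>0 complex) - 1 \<in> uea_ideal"
  have "lie_hom_commutator (\<lambda>_::'g. 0 :: complex)"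
    by (simp add: lie_hom_commutator_def linear_scaleCI)
  from free_eval_uea_ideal [OF this *] show False
    by (simp only: free_eval_diff) simp
qed

instantiation uea :: (complex_lie_algebra) complex_algebra_1
begin

lift_definition zero_uea :: "'a uea" is 0 .

lift_definition one_uea :: "'a uea" is 1 .

lift_definition plus_uea :: "'a uea \<Rightarrow> 'a uea \<Rightarrow> 'a uea" is "(+)"
  by (drule (1) uea_ideal_add) (simp add: algebra_simps)

lift_definition uminus_uea :: "'a uea \<Rightarrow> 'a uea" is uminus
  by (drule uea_ideal_uminus) simp

lift_definition minus_uea :: "'a uea \<Rightarrow> 'a uea \<Rightarrow> 'a uea" is "(-)"
  by (drule uea_ideal_uminus, drule (1) uea_ideal_add) (simp add: algebra_simps)

lift_definition times_uea :: "'a uea \<Rightarrow> 'a uea \<Rightarrow> 'a uea" is "(*)"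
proof -
  fix p p' q q' :: "'a word \<Rightarrow>\<^sub>0 complex"
  assume "p - p' \<in> uea_ideal" "q - q' \<in> uea_ideal"
  then have "(p - p') * q + p' * (q - q') \<in> uea_ideal"
    by (intro uea_ideal_add uea_ideal_mult_left uea_ideal_mult_right)
  then show "p * q - p' * q' \<in> uea_ideal"
    by (simp add: algebra_simps)
qed

lift_definition scaleC_uea :: "complex \<Rightarrow> 'a uea \<Rightarrow> 'a uea" is scaleC
  by (drule uea_ideal_scaleC) (simp add: complex_vector.scale_right_diff_distrib)

instance
proof
  show "(0 :: 'a uea) \<noteq> 1"
    by transfer (rule uea_zero_neq_one)
  fix u v w :: "'a uea" and c d :: complex
  obtain p q r where [simp]: "u = abs_uea p" "v = abs_uea q" "w = abs_uea r"
    by (rule that; rule Quotient3_abs_rep [OF Quotient3_uea, symmetric])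
  note abs_eqs = zero_uea_def one_uea_def plus_uea.abs_eq uminus_uea.abs_eq minus_uea.abs_eq
    times_uea.abs_eq scaleC_uea.abs_eq
  show "u + v + w = u + (v + w)"
    by (simp add: abs_eqs add.assoc)
  show "u + v = v + u"
    by (simp add: abs_eqs add.commute)
  show "0 + u = u"
    by (simp add: abs_eqs)
  show "- u + u = 0"
    by (simp add: abs_eqs)
  show "u - v = u + - v"
    by (simp add: abs_eqs)
  show "u * v * w = u * (v * w)"
    by (simp add: abs_eqs mult.assoc)
  show "1 * u = u"
    by (simp add: abs_eqs)
  show "u * 1 = u"
    by (simp add: abs_eqs)
  show "(u + v) * w = u * w + v * w"
    by (simp add: abs_eqs distrib_right)
  show "u * (v + w) = u * v + u * w"
    by (simp add: abs_eqs distrib_left)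
  show "c *\<^sub>C (u + v) = c *\<^sub>C u + c *\<^sub>C v"
    by (simp add: abs_eqs scaleC_add_right)
  show "(c + d) *\<^sub>C u = c *\<^sub>C u + d *\<^sub>C u"
    by (simp add: abs_eqs scaleC_add_left)
  show "c *\<^sub>C d *\<^sub>C u = (c * d) *\<^sub>C u"
    by (simp add: abs_eqs)
  show "1 *\<^sub>C u = u"
    by (simp add: abs_eqs)
  show "(c *\<^sub>C u) * v = c *\<^sub>C (u * v)"
    by (simp add: abs_eqs)
  show "u * (c *\<^sub>C v) = c *\<^sub>C (u * v)"
    by (simp add: abs_eqs)
qed

end

lift_definition uea_of :: "'g::complex_lie_algebra \<Rightarrow> 'g uea" is free_gen .

lemma uea_of_add: "uea_of (x + y) = uea_of x + uea_of y"
  and uea_of_scaleC: "uea_of (c *\<^sub>C x) = c *\<^sub>C uea_of x"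
  and uea_of_commutator: "uea_of x * uea_of y - uea_of y * uea_of x = uea_of (lie_bracket x y)"
proof -
  have rel: "uea_relators \<subseteq> uea_ideal"
    by (auto simp: uea_ideal_def hull_inc)
  have "free_gen (x + y) - free_gen x - free_gen y \<in> uea_relators"
    unfolding uea_relators_def by blast
  then show "uea_of (x + y) = uea_of x + uea_of y"
    using rel by (auto simp: uea_of.abs_eq plus_uea.abs_eq uea.abs_eq_iff diff_diff_eq)
  have "free_gen (c *\<^sub>C x) - c *\<^sub>C free_gen x \<in> uea_relators"
    unfolding uea_relators_def by blast
  then show "uea_of (c *\<^sub>C x) = c *\<^sub>C uea_of x"
    using rel by (auto simp: uea_of.abs_eq scaleC_uea.abs_eq uea.abs_eq_iff)
  have "free_gen x * free_gen y - free_gen y * free_gen x - free_gen (lie_bracket x y)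
      \<in> uea_relators"
    unfolding uea_relators_def by blast
  then show "uea_of x * uea_of y - uea_of y * uea_of x = uea_of (lie_bracket x y)"
    using rel
    by (auto simp: uea_of.abs_eq times_uea.abs_eq minus_uea.abs_eq uea.abs_eq_iff)
qed

lemma lie_hom_commutator_uea_of: "lie_hom_commutator uea_of"
  by (simp add: lie_hom_commutator_def linear_scaleCI uea_of_add uea_of_scaleC uea_of_commutator)

text \<open>
  The extension of a Lie algebra homomorphism to the universal enveloping algebra, given by
  evaluation of a representative; it does not depend on the representative if
  \<open>lie_hom_commutator f\<close>.
\<close>

definition uea_lift :: "('g::complex_lie_algebra \<Rightarrow> 'a::complex_algebra_1) \<Rightarrow> 'g uea \<Rightarrow> 'a" where
  "uea_lift f u = free_eval f (rep_uea u)"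

lemma uea_lift_abs:
  assumes "lie_hom_commutator f"
  shows "uea_lift f (abs_uea p) = free_eval f p"
proof -
  have "rep_uea (abs_uea p) - p \<in> uea_ideal"
    using Quotient3_uea rep_abs_rsp_left [OF Quotient3_uea, of p p]
    by (simp add: uea_ideal_zero)
  from free_eval_uea_ideal [OF assms this] show ?thesis
    by (simp add: uea_lift_def free_eval_diff)
qed

lemma
  assumes "lie_hom_commutator f"
  shows uea_lift_add: "uea_lift f (u + v) = uea_lift f u + uea_lift f v"
    and uea_lift_scaleC: "uea_lift f (c *\<^sub>C u) = c *\<^sub>C uea_lift f u"
    and uea_lift_mult: "uea_lift f (u * v) = uea_lift f u * uea_lift f v"
    and uea_lift_one: "uea_lift f 1 = 1"
    and uea_lift_of: "uea_lift f (uea_of x) = f x"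
proof -
  obtain p q where [simp]: "u = abs_uea p" "v = abs_uea q"
    by (rule that; rule Quotient3_abs_rep [OF Quotient3_uea, symmetric])
  note abs = uea_lift_abs [OF assms]
  show "uea_lift f (u + v) = uea_lift f u + uea_lift f v"
    by (simp add: plus_uea.abs_eq abs free_eval_add)
  show "uea_lift f (c *\<^sub>C u) = c *\<^sub>C uea_lift f u"
    by (simp add: scaleC_uea.abs_eq abs free_eval_scaleC)
  show "uea_lift f (u * v) = uea_lift f u * uea_lift f v"
    by (simp add: times_uea.abs_eq abs free_eval_mult)
  show "uea_lift f 1 = 1"
    by (simp add: one_uea_def abs)
  show "uea_lift f (uea_of x) = f x"
    by (simp add: uea_of.abs_eq abs)
qed

definition uea_map :: "('g::complex_lie_algebra \<Rightarrow> 'h::complex_lie_algebra) \<Rightarrow> 'g uea \<Rightarrow> 'h uea" where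
  "uea_map f = uea_lift (\<lambda>x. uea_of (f x))"

definition subalgebra :: "'a::complex_algebra_1 set \<Rightarrow> bool" where
  "subalgebra A \<longleftrightarrow> 1 \<in> A \<and> (\<forall>x\<in>A. \<forall>y\<in>A. x + y \<in> A \<and> x * y \<in> A) \<and>
     (\<forall>c. \<forall>x\<in>A. c *\<^sub>C x \<in> A)"


section \<open>The Schroedinger-Virasoro algebra\<close>

text \<open>\<open>IY n\<close> is the index of \<open>Y\<^bsub>n+1/2\<^esub>\<close>.\<close>

datatype sv_index = IL int | IM int | IY int

fun sv_basis_bracket :: "sv_index \<Rightarrow> sv_index \<Rightarrow> (sv_index \<Rightarrow>\<^sub>0 complex)" where
  "sv_basis_bracket (IL m) (IL n) = Poly_Mapping.single (IL (m + n)) (of_int (n - m))"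
| "sv_basis_bracket (IL m) (IM n) = Poly_Mapping.single (IM (m + n)) (of_int n)"
| "sv_basis_bracket (IL m) (IY n) =
     Poly_Mapping.single (IY (m + n)) (of_int n + (1 - of_int m) / 2)"
| "sv_basis_bracket (IY m) (IY n) = Poly_Mapping.single (IM (m + n + 1)) (of_int (n - m))"
| "sv_basis_bracket (IM m) (IL n) = - Poly_Mapping.single (IM (n + m)) (of_int m)"
| "sv_basis_bracket (IY m) (IL n) =
     - Poly_Mapping.single (IY (n + m)) (of_int m + (1 - of_int n) / 2)"
| "sv_basis_bracket (IM m) (IM n) = 0"
| "sv_basis_bracket (IM m) (IY n) = 0"
| "sv_basis_bracket (IY m) (IM n) = 0"

definition sv_coeff_bracket ::
    "(sv_index \<Rightarrow>\<^sub>0 complex) \<Rightarrow> (sv_index \<Rightarrow>\<^sub>0 complex) \<Rightarrow> (sv_index \<Rightarrow>\<^sub>0 complex)" where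
  "sv_coeff_bracket p q = lin_ext (\<lambda>i. lin_ext (sv_basis_bracket i) q) p"

lemma sv_coeff_bracket_add_left:
    "sv_coeff_bracket (p + q) r = sv_coeff_bracket p r + sv_coeff_bracket q r"
  and sv_coeff_bracket_add_right:
    "sv_coeff_bracket r (p + q) = sv_coeff_bracket r p + sv_coeff_bracket r q"
  and sv_coeff_bracket_scaleC_left: "sv_coeff_bracket (c *\<^sub>C p) r = c *\<^sub>C sv_coeff_bracket p r"
  and sv_coeff_bracket_scaleC_right: "sv_coeff_bracket r (c *\<^sub>C p) = c *\<^sub>C sv_coeff_bracket r p"
  and sv_coeff_bracket_zero_left [simp]: "sv_coeff_bracket 0 r = 0"
  and sv_coeff_bracket_zero_right [simp]: "sv_coeff_bracket r 0 = 0"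
  and sv_coeff_bracket_uminus_right: "sv_coeff_bracket r (- p) = - sv_coeff_bracket r p"
  and sv_coeff_bracket_single:
    "sv_coeff_bracket (Poly_Mapping.single i a) (Poly_Mapping.single j b) =
       a *\<^sub>C b *\<^sub>C sv_basis_bracket i j"
  by (simp_all add: sv_coeff_bracket_def lin_ext_add lin_ext_scaleC lin_ext_fun_add
      lin_ext_fun_scaleC lin_ext_uminus)
    (simp_all add: lin_ext_def sum_negf)

lemma sv_basis_bracket_swap: "sv_basis_bracket i j = - sv_basis_bracket j i"
  by (cases i; cases j) (simp_all add: add.commute flip: single_uminus)

lemma sv_coeff_bracket_swap: "sv_coeff_bracket p q = - sv_coeff_bracket q p"
proof (induction p rule: poly_mapping_linear_induct)
  case (single c i)
  show ?case
  proof (induction q rule: poly_mapping_linear_induct)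
    case (single d j)
    show ?case
      using sv_basis_bracket_swap [of i j]
      by (simp add: sv_coeff_bracket_single scaleC_complex_def mult.commute)
  qed (simp_all add: sv_coeff_bracket_add_left sv_coeff_bracket_add_right)
qed (simp_all add: sv_coeff_bracket_add_left sv_coeff_bracket_add_right)

lemma sv_basis_jacobi:
  fixes i j k :: sv_index
  defines "e \<equiv> \<lambda>i. Poly_Mapping.single i (1 :: complex)"
  shows "sv_coeff_bracket (e i) (sv_basis_bracket j k) +
    sv_coeff_bracket (e j) (sv_basis_bracket k i) +
    sv_coeff_bracket (e k) (sv_basis_bracket i j) = 0"
  unfolding e_def
  by (cases i; cases j; cases k;
      simp add: sv_coeff_bracket_single sv_coeff_bracket_uminus_right scaleC_complex_def ac_simps
        flip: single_add single_uminus)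
    (simp_all add: field_simps)

lemma sv_coeff_jacobi:
  "sv_coeff_bracket x (sv_coeff_bracket y z) + sv_coeff_bracket y (sv_coeff_bracket z x) +
     sv_coeff_bracket z (sv_coeff_bracket x y) = 0"
proof -
  define J where "J x y z = sv_coeff_bracket x (sv_coeff_bracket y z) +
    sv_coeff_bracket y (sv_coeff_bracket z x) + sv_coeff_bracket z (sv_coeff_bracket x y)" for x y z
  note lin = sv_coeff_bracket_add_left sv_coeff_bracket_add_right
    sv_coeff_bracket_scaleC_left sv_coeff_bracket_scaleC_right
  have add: "J (x + x') y z = J x y z + J x' y z" "J x (y + y') z = J x y z + J x y' z"
    "J x y (z + z') = J x y z + J x y z'" for x x' y y' z z'
    by (simp_all add: J_def lin ac_simps)
  have scale: "J (c *\<^sub>C x) y z = c *\<^sub>C J x y z" "J x (c *\<^sub>C y) z = c *\<^sub>C J x y z"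
    "J x y (c *\<^sub>C z) = c *\<^sub>C J x y z" for c x y z
    by (simp_all only: J_def lin scaleC_add_right)
  have zero: "J 0 y z = 0" "J x 0 z = 0" "J x y 0 = 0" for x y z
    by (simp_all add: J_def)
  have base: "J (Poly_Mapping.single i 1) (Poly_Mapping.single j 1) (Poly_Mapping.single k 1) = 0"
    for i j k
    using sv_basis_jacobi by (simp add: J_def sv_coeff_bracket_single)
  have "J x y z = 0"
  proof (induction x rule: poly_mapping_linear_induct)
    case (single c i)
    show ?case
    proof (induction y rule: poly_mapping_linear_induct)
      case (single d j)
      show ?case
      proof (induction z rule: poly_mapping_linear_induct)
        case (single e k)
        show ?case
          by (simp only: scale base complex_vector.scale_zero_right)
      qed (simp_all only: add zero add_0_left)
    qed (simp_all only: add zero add_0_left)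
  qed (simp_all only: add zero add_0_left)
  then show ?thesis by (simp only: J_def)
qed

typedef sv = "UNIV :: (sv_index \<Rightarrow>\<^sub>0 complex) set"
  morphisms sv_coeffs Abs_sv ..

setup_lifting type_definition_sv

instantiation sv :: complex_lie_algebra
begin

lift_definition zero_sv :: sv is 0 .

lift_definition plus_sv :: "sv \<Rightarrow> sv \<Rightarrow> sv" is "(+)" .

lift_definition uminus_sv :: "sv \<Rightarrow> sv" is uminus .

lift_definition minus_sv :: "sv \<Rightarrow> sv \<Rightarrow> sv" is "(-)" .

lift_definition scaleC_sv :: "complex \<Rightarrow> sv \<Rightarrow> sv" is scaleC .

lift_definition lie_bracket_sv :: "sv \<Rightarrow> sv \<Rightarrow> sv" is sv_coeff_bracket .

instance
proof
  fix x y z :: sv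
  show "lie_bracket x x = 0"
  proof transfer
    fix p :: "sv_index \<Rightarrow>\<^sub>0 complex"
    have "2 *\<^sub>C sv_coeff_bracket p p = sv_coeff_bracket p p + sv_coeff_bracket p p"
      using scaleC_add_left [of 1 1 "sv_coeff_bracket p p"] by simp
    also have "\<dots> = 0"
      using sv_coeff_bracket_swap [of p p] by (simp add: eq_neg_iff_add_eq_0)
    finally show "sv_coeff_bracket p p = 0"
      by simp
  qed
  show "lie_bracket x (lie_bracket y z) + lie_bracket y (lie_bracket z x)
      + lie_bracket z (lie_bracket x y) = 0"
    by transfer (rule sv_coeff_jacobi)
qed (transfer; simp add: add_ac scaleC_add_right scaleC_add_left
    sv_coeff_bracket_add_left sv_coeff_bracket_add_right
    sv_coeff_bracket_scaleC_left sv_coeff_bracket_scaleC_right)+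

end

lift_definition sv_L :: "int \<Rightarrow> sv" is "\<lambda>n. Poly_Mapping.single (IL n) 1" .

lift_definition sv_M :: "int \<Rightarrow> sv" is "\<lambda>n. Poly_Mapping.single (IM n) 1" .

text \<open>\<open>sv_Y n\<close> is \<open>Y\<^bsub>n+1/2\<^esub>\<close>.\<close>

lift_definition sv_Y :: "int \<Rightarrow> sv" is "\<lambda>n. Poly_Mapping.single (IY n) 1" .

lemma sv_brackets:
  "lie_bracket (sv_L m) (sv_L n) = of_int (n - m) *\<^sub>C sv_L (m + n)"
  "lie_bracket (sv_L m) (sv_M n) = of_int n *\<^sub>C sv_M (m + n)"
  "lie_bracket (sv_L m) (sv_Y n) = (of_int n + (1 - of_int m) / 2) *\<^sub>C sv_Y (m + n)"
  "lie_bracket (sv_Y m) (sv_Y n) = of_int (n - m) *\<^sub>C sv_M (m + n + 1)"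
  "lie_bracket (sv_M m) (sv_M n) = 0"
  "lie_bracket (sv_M m) (sv_Y n) = 0"
  "lie_bracket (sv_M m) (sv_L n) = - of_int m *\<^sub>C sv_M (m + n)"
  "lie_bracket (sv_Y m) (sv_L n) = - (of_int m + (1 - of_int n) / 2) *\<^sub>C sv_Y (m + n)"
  "lie_bracket (sv_Y m) (sv_M n) = 0"
  by (transfer; simp add: sv_coeff_bracket_single scaleC_complex_def add.commute
      flip: single_uminus)+

definition sv_plus_basis :: "sv set" where
  "sv_plus_basis = {sv_L n | n. n \<ge> 1} \<union> {sv_M n | n. n \<ge> 1} \<union> {sv_Y n | n. n \<ge> 0}"

lemma sv_plus_basis_bracket:
  assumes "x \<in> sv_plus_basis" "y \<in> sv_plus_basis"
  shows "lie_bracket x y \<in> complex_vector.span sv_plus_basis"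
proof -
  have *: "sv_L n \<in> complex_vector.span sv_plus_basis"
    "sv_M n \<in> complex_vector.span sv_plus_basis" if "n \<ge> 1" for n
    using that by (auto simp: sv_plus_basis_def intro!: complex_vector.span_base)
  have **: "sv_Y n \<in> complex_vector.span sv_plus_basis" if "n \<ge> 0" for n
    using that by (auto simp: sv_plus_basis_def intro!: complex_vector.span_base)
  have "(\<exists>n\<ge>1. z = sv_L n) \<or> (\<exists>n\<ge>1. z = sv_M n) \<or> (\<exists>n\<ge>0. z = sv_Y n)"
    if "z \<in> sv_plus_basis" for z
    using that by (auto simp: sv_plus_basis_def)
  from this [OF assms(1)] this [OF assms(2)] show ?thesis
    by (elim disjE exE conjE; simp only: sv_brackets complex_vector.span_zero)
      (intro complex_vector.span_scale * **; simp)+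
qed

lemma sv_plus_bracket:
  assumes "x \<in> complex_vector.span sv_plus_basis" "y \<in> complex_vector.span sv_plus_basis"
  shows "lie_bracket x y \<in> complex_vector.span sv_plus_basis"
proof -
  have zero: "lie_bracket 0 z = 0" "lie_bracket z 0 = 0" for z :: sv
    using lie_bracket_scaleC_left [of 0 0 z] lie_bracket_scaleC_right [of z 0 0] by simp_all
  note lin = lie_bracket_add_left lie_bracket_add_right lie_bracket_scaleC_left
    lie_bracket_scaleC_right
  have 1: "lie_bracket x b \<in> complex_vector.span sv_plus_basis" if "b \<in> sv_plus_basis" for b
    using assms(1)
    by (induction x rule: complex_vector.span_induct_alt)
      (simp_all add: zero lin complex_vector.span_zero complex_vector.span_add
        complex_vector.span_scale sv_plus_basis_bracket that)
  show ?thesis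
    using assms(2)
    by (induction y rule: complex_vector.span_induct_alt)
      (simp_all add: zero lin complex_vector.span_zero complex_vector.span_add
        complex_vector.span_scale 1)
qed

typedef sv_plus = "complex_vector.span sv_plus_basis"
  morphisms sv_plus_incl Abs_sv_plus
  using complex_vector.span_zero by blast

setup_lifting type_definition_sv_plus

instantiation sv_plus :: complex_lie_algebra
begin

lift_definition zero_sv_plus :: sv_plus is 0
  by (rule complex_vector.span_zero)

lift_definition plus_sv_plus :: "sv_plus \<Rightarrow> sv_plus \<Rightarrow> sv_plus" is "(+)"
  by (rule complex_vector.span_add)

lift_definition uminus_sv_plus :: "sv_plus \<Rightarrow> sv_plus" is uminus
  by (rule complex_vector.span_neg)

lift_definition minus_sv_plus :: "sv_plus \<Rightarrow> sv_plus \<Rightarrow> sv_plus" is "(-)"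
  by (rule complex_vector.span_diff)

lift_definition scaleC_sv_plus :: "complex \<Rightarrow> sv_plus \<Rightarrow> sv_plus" is scaleC
  by (rule complex_vector.span_scale)

lift_definition lie_bracket_sv_plus :: "sv_plus \<Rightarrow> sv_plus \<Rightarrow> sv_plus" is lie_bracket
  by (rule sv_plus_bracket)

instance
proof
  fix x y z :: sv_plus
  show "lie_bracket x (lie_bracket y z) + lie_bracket y (lie_bracket z x)
      + lie_bracket z (lie_bracket x y) = 0"
    by transfer (rule lie_jacobi)
qed (transfer; simp add: add_ac scaleC_add_right scaleC_add_left lie_bracket_add_left
    lie_bracket_add_right lie_bracket_scaleC_left lie_bracket_scaleC_right lie_bracket_self)+

end

lemma lie_hom_sv_plus_incl: "lie_hom sv_plus_incl"
  by (simp add: lie_hom_def linear_scaleCI plus_sv_plus.rep_eq scaleC_sv_plus.rep_eq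
      lie_bracket_sv_plus.rep_eq)


section \<open>Tensor products and quotients of modules\<close>

definition add_subgroup :: "'a::ab_group_add set \<Rightarrow> bool" where
  "add_subgroup S \<longleftrightarrow> 0 \<in> S \<and> (\<forall>x\<in>S. \<forall>y\<in>S. x + y \<in> S) \<and> (\<forall>x\<in>S. - x \<in> S)"

lemma add_subgroup_hull: "add_subgroup (add_subgroup hull S)"
  by (rule hull_in) (auto simp: add_subgroup_def)

text \<open>
  The tensor product of a right module with action \<open>ra\<close> and a left module with action \<open>la\<close> over a
  ring \<open>'r\<close> is the quotient of the free abelian group on all pairs by this subgroup.
\<close>

definition tensor_null ::
    "('m::ab_group_add \<Rightarrow> 'r \<Rightarrow> 'm) \<Rightarrow> ('r \<Rightarrow> 'n::ab_group_add \<Rightarrow> 'n) \<Rightarrow> ('m \<times> 'n \<Rightarrow>\<^sub>0 int) set" where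
  "tensor_null ra la = add_subgroup hull
     ({frag_of (m + m', n) - frag_of (m, n) - frag_of (m', n) | m m' n. True} \<union>
      {frag_of (m, n + n') - frag_of (m, n) - frag_of (m, n') | m n n'. True} \<union>
      {frag_of (ra m r, n) - frag_of (m, la r n) | m r n. True})"

text \<open>
  The quotient of a module with carrier \<open>V\<close> by a submodule \<open>N\<close> consists of the cosets of \<open>N\<close>,
  added as sets. Since \<open>V\<close> may itself be such a quotient, only the addition of the type of its
  elements is used; \<open>N\<close> is the zero of the quotient.
\<close>

definition quotient_module :: "'a::plus set \<Rightarrow> 'a set \<Rightarrow> 'a set set" where
  "quotient_module V N = {v +o N | v. v \<in> V}"

text \<open>
  An operator \<open>f\<close> on \<open>V\<close> leaving \<open>N\<close> invariant sends the coset of \<open>v\<close> to that of \<open>f v\<close>.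
\<close>

definition quotient_op :: "'a::plus set \<Rightarrow> ('a \<Rightarrow> 'a) \<Rightarrow> 'a set \<Rightarrow> 'a set" where
  "quotient_op N f A = f ` A + N"


section \<open>The universal Whittaker modules\<close>

text \<open>
  \<open>U(sv)\<close> is a right \<open>U(sv\<^sup>+)\<close>-module through the inclusion, and \<open>U(sv\<^sup>+)\<close> acts on
  the one-dimensional module by the extension of \<open>\<psi>\<close>.
\<close>

definition W_null :: "(sv_plus \<Rightarrow> complex) \<Rightarrow> (sv uea \<times> complex \<Rightarrow>\<^sub>0 int) set" where
  "W_null \<psi> = tensor_null (\<lambda>u r. u * uea_map sv_plus_incl r) (\<lambda>r \<alpha>. uea_lift \<psi> r * \<alpha>)"

definition W_carrier :: "(sv_plus \<Rightarrow> complex) \<Rightarrow> (sv uea \<times> complex \<Rightarrow>\<^sub>0 int) set set" where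
  "W_carrier \<psi> = quotient_module UNIV (W_null \<psi>)"

definition W_act :: "(sv_plus \<Rightarrow> complex) \<Rightarrow> sv uea \<Rightarrow>
    (sv uea \<times> complex \<Rightarrow>\<^sub>0 int) set \<Rightarrow> (sv uea \<times> complex \<Rightarrow>\<^sub>0 int) set" where
  "W_act \<psi> u = quotient_op (W_null \<psi>) (frag_extend (\<lambda>(v, \<alpha>). frag_of (u * v, \<alpha>)))"

definition W_generator :: "(sv_plus \<Rightarrow> complex) \<Rightarrow> (sv uea \<times> complex \<Rightarrow>\<^sub>0 int) set" where
  "W_generator \<psi> = frag_of (1, 1) +o W_null \<psi>"

definition L_null :: "(sv_plus \<Rightarrow> complex) \<Rightarrow> complex \<Rightarrow> (sv uea \<times> complex \<Rightarrow>\<^sub>0 int) set set" where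
  "L_null \<psi> \<xi> = W_act \<psi> (uea_of (sv_M 0) - \<xi> *\<^sub>C 1) ` W_carrier \<psi>"

definition L_carrier ::
    "(sv_plus \<Rightarrow> complex) \<Rightarrow> complex \<Rightarrow> (sv uea \<times> complex \<Rightarrow>\<^sub>0 int) set set set" where
  "L_carrier \<psi> \<xi> = quotient_module (W_carrier \<psi>) (L_null \<psi> \<xi>)"

definition L_act :: "(sv_plus \<Rightarrow> complex) \<Rightarrow> complex \<Rightarrow> sv uea \<Rightarrow>
    (sv uea \<times> complex \<Rightarrow>\<^sub>0 int) set set \<Rightarrow> (sv uea \<times> complex \<Rightarrow>\<^sub>0 int) set set" where
  "L_act \<psi> \<xi> u = quotient_op (L_null \<psi> \<xi>) (W_act \<psi> u)"

definition L_generator ::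
    "(sv_plus \<Rightarrow> complex) \<Rightarrow> complex \<Rightarrow> (sv uea \<times> complex \<Rightarrow>\<^sub>0 int) set set" where
  "L_generator \<psi> \<xi> = W_generator \<psi> +o L_null \<psi> \<xi>"

text \<open>
  The scalar multiple \<open>\<psi>(x) v\<close> is the action of \<open>\<psi>(x) 1 \<in> U(sv)\<close> on \<open>v\<close>; the cosets carry no
  scalar multiplication of their own.
\<close>

definition whittaker_vectors ::
    "(sv_plus \<Rightarrow> complex) \<Rightarrow> complex \<Rightarrow> (sv uea \<times> complex \<Rightarrow>\<^sub>0 int) set set set" where
  "whittaker_vectors \<psi> \<xi> = {v \<in> L_carrier \<psi> \<xi>.
     \<forall>x. L_act \<psi> \<xi> (uea_of (sv_plus_incl x)) v = L_act \<psi> \<xi> (\<psi> x *\<^sub>C 1) v}"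

definition C_L0 :: "sv uea set" where
  "C_L0 = subalgebra hull {uea_of (sv_L 0)}"


subsection \<open>Well-definedness\<close>

lemma lie_hom_complex_iff:
  fixes \<psi> :: "'g::complex_lie_algebra \<Rightarrow> complex"
  shows "lie_hom \<psi> \<longleftrightarrow> lie_hom_commutator \<psi>"
  by (simp add: lie_hom_def lie_hom_commutator_def lie_bracket_complex_def mult.commute)

lemma lie_hom_commutator_sv_plus: "lie_hom_commutator (\<lambda>x. uea_of (sv_plus_incl x))"
  by (simp add: lie_hom_commutator_def linear_scaleCI plus_sv_plus.rep_eq scaleC_sv_plus.rep_eq
      lie_bracket_sv_plus.rep_eq uea_of_add uea_of_scaleC uea_of_commutator)

lemma add_subgroupI:
  "0 \<in> S \<Longrightarrow> (\<And>x y. x \<in> S \<Longrightarrow> y \<in> S \<Longrightarrow> x + y \<in> S) \<Longrightarrow>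
     (\<And>x. x \<in> S \<Longrightarrow> - x \<in> S) \<Longrightarrow> add_subgroup S"
  by (simp add: add_subgroup_def)

lemma add_subgroupD:
  assumes "add_subgroup S"
  shows "0 \<in> S" and "x \<in> S \<Longrightarrow> y \<in> S \<Longrightarrow> x + y \<in> S" and "x \<in> S \<Longrightarrow> - x \<in> S"
  using assms by (auto simp: add_subgroup_def)

lemma add_subgroup_set_plus: "add_subgroup N \<Longrightarrow> N + N = N"
  unfolding add_subgroup_def set_plus_def by (auto intro: exI [of _ 0]) force

lemma add_subgroup_coset_plus:
  "add_subgroup N \<Longrightarrow> (x +o N) + (y +o N) = (x + y) +o N"
  by (simp add: set_plus_rearrange add_subgroup_set_plus)

lemma quotient_op_coset:
  assumes N: "add_subgroup N" and add: "\<And>x y. f (x + y) = f x + f y" and fN: "f ` N \<subseteq> N"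
  shows "quotient_op N f (x +o N) = f x +o N"
proof
  show "quotient_op N f (x +o N) \<subseteq> f x +o N"
    using N fN
    by (auto simp: quotient_op_def elt_set_plus_def set_plus_def add add_subgroup_def add.assoc)
  have "f 0 = 0" using add [of 0 0] by simp
  then show "f x +o N \<subseteq> quotient_op N f (x +o N)"
    using N
    by (force simp: quotient_op_def elt_set_plus_def set_plus_def add_subgroup_def)
qed

lemma add_subgroup_W_null: "add_subgroup (W_null \<psi>)"
  by (simp add: W_null_def tensor_null_def add_subgroup_hull)

lemma W_null_left_mult:
  assumes "t \<in> W_null \<psi>"
  shows "frag_extend (\<lambda>(v, \<alpha>). frag_of (u * v, \<alpha>)) t \<in> W_null \<psi>"
  using assms unfolding W_null_def tensor_null_def
proof (rule hull_induct, goal_cases)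
  case (1 t)
  let ?R = "{frag_of (m + m', n) - frag_of (m, n) - frag_of (m', n) | m m' n. True} \<union>
      {frag_of (m, n + n') - frag_of (m, n) - frag_of (m, n') | m n n'. True} \<union>
      {frag_of (m * uea_map sv_plus_incl r, n) - frag_of (m, uea_lift \<psi> r * n) | m r n. True}"
  from 1 have "frag_extend (\<lambda>(v, \<alpha>). frag_of (u * v, \<alpha>)) t \<in> ?R"
  proof (elim UnE)
    assume "t \<in> {frag_of (m + m', n) - frag_of (m, n) - frag_of (m', n) | m m' n. True}"
    then obtain m m' n where "t = frag_of (m + m', n) - frag_of (m, n) - frag_of (m', n)"
      by blast
    then have "frag_extend (\<lambda>(v, \<alpha>). frag_of (u * v, \<alpha>)) t =
        frag_of (u * m + u * m', n) - frag_of (u * m, n) - frag_of (u * m', n)"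
      by (simp add: frag_extend_diff distrib_left)
    then show ?thesis by blast
  next
    assume "t \<in> {frag_of (m, n + n') - frag_of (m, n) - frag_of (m, n') | m n n'. True}"
    then obtain m n n' where "t = frag_of (m, n + n') - frag_of (m, n) - frag_of (m, n')"
      by blast
    then have "frag_extend (\<lambda>(v, \<alpha>). frag_of (u * v, \<alpha>)) t =
        frag_of (u * m, n + n') - frag_of (u * m, n) - frag_of (u * m, n')"
      by (simp add: frag_extend_diff)
    then show ?thesis by blast
  next
    assume "t \<in> {frag_of (m * uea_map sv_plus_incl r, n) - frag_of (m, uea_lift \<psi> r * n)
      | m r n. True}"
    then obtain m r n
      where "t = frag_of (m * uea_map sv_plus_incl r, n) - frag_of (m, uea_lift \<psi> r * n)"
      by blast
    then have "frag_extend (\<lambda>(v, \<alpha>). frag_of (u * v, \<alpha>)) t =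
        frag_of (u * m * uea_map sv_plus_incl r, n) - frag_of (u * m, uea_lift \<psi> r * n)"
      by (simp add: frag_extend_diff mult.assoc)
    then show ?thesis by blast
  qed
  then show ?case
    by (rule hull_inc)
next
  case 2
  show ?case
    by (rule add_subgroupI)
      (simp_all add: frag_extend_add frag_extend_minus add_subgroupD [OF add_subgroup_hull])
qed

lemma W_act_coset:
  "W_act \<psi> u (t +o W_null \<psi>) = frag_extend (\<lambda>(v, \<alpha>). frag_of (u * v, \<alpha>)) t +o W_null \<psi>"
  unfolding W_act_def
  by (rule quotient_op_coset)
    (auto simp: add_subgroup_W_null frag_extend_add W_null_left_mult)

lemma uea_induct [case_names one gen add scaleC mult]:
  assumes one: "P 1" and gen: "\<And>x. P (uea_of x)"
    and add: "\<And>u v. P u \<Longrightarrow> P v \<Longrightarrow> P (u + v)" and scale: "\<And>c u. P u \<Longrightarrow> P (c *\<^sub>C u)"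
    and mult: "\<And>u v. P u \<Longrightarrow> P v \<Longrightarrow> P (u * v)"
  shows "P u"
proof -
  obtain p where u: "u = abs_uea p"
    by (rule that; rule Quotient3_abs_rep [OF Quotient3_uea, symmetric])
  have word: "P (abs_uea (Poly_Mapping.single w 1))" for w
  proof (cases w)
    case (Word xs)
    have "P (abs_uea (Poly_Mapping.single (Word xs) 1))"
    proof (induction xs)
      case Nil
      show ?case
        using one by (simp add: one_uea_def flip: zero_word_def)
    next
      case (Cons x xs)
      have "Poly_Mapping.single (Word (x # xs)) (1 :: complex)
          = free_gen x * Poly_Mapping.single (Word xs) 1"
        by (simp add: free_gen_def mult_single plus_word_def)
      then show ?case
        using mult [OF gen [of x] Cons] by (simp add: uea_of.abs_eq times_uea.abs_eq)
    qed
    then show ?thesis by (simp add: Word)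
  qed
  have "P (abs_uea p)"
  proof (induction p rule: poly_mapping_linear_induct)
    case zero
    show ?case using scale [OF one, of 0] by (simp add: zero_uea_def)
  next
    case (add p q)
    then show ?case using assms(3) by (simp flip: plus_uea.abs_eq)
  next
    case (single c w)
    show ?case using scale [OF word] by (simp only: scaleC_uea.abs_eq)
  qed
  then show ?thesis by (simp only: u)
qed

lemma uea_of_central:
  assumes "\<And>y. lie_bracket x y = 0"
  shows "uea_of x * u = u * uea_of x"
proof (induction u rule: uea_induct)
  case (gen y)
  have "uea_of (lie_bracket x y) = 0"
    using uea_of_scaleC [of 0 x] assms by simp
  then show ?case
    using uea_of_commutator [of x y] by simp
next
  case (mult u v)
  then show ?case by (metis mult.assoc)
qed (simp_all add: distrib_left distrib_right)

lemma sv_M0_central: "lie_bracket (sv_M 0) y = 0"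
proof transfer
  fix q
  show "sv_coeff_bracket (Poly_Mapping.single (IM 0) 1) q = 0"
  proof (induction q rule: poly_mapping_linear_induct)
    case (single c i)
    show ?case by (cases i) (simp_all add: sv_coeff_bracket_single)
  qed (simp_all add: sv_coeff_bracket_add_right)
qed

lemma W_carrier_cases:
  assumes "w \<in> W_carrier \<psi>"
  obtains t where "w = t +o W_null \<psi>"
  using assms by (auto simp: W_carrier_def quotient_module_def)

lemma W_carrier_coset [simp]: "t +o W_null \<psi> \<in> W_carrier \<psi>"
  by (auto simp: W_carrier_def quotient_module_def)

lemma W_coset_eqI:
  assumes "s - t \<in> W_null \<psi>"
  shows "s +o W_null \<psi> = t +o W_null \<psi>"
proof
  have diff: "- (s - t) \<in> W_null \<psi>"
    using assms add_subgroup_W_null unfolding add_subgroup_def by blast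
  have add: "x + y \<in> W_null \<psi>" if "x \<in> W_null \<psi>" "y \<in> W_null \<psi>" for x y
    using that add_subgroup_W_null unfolding add_subgroup_def by blast
  show "s +o W_null \<psi> \<subseteq> t +o W_null \<psi>"
  proof
    fix x assume "x \<in> s +o W_null \<psi>"
    then obtain n where n: "n \<in> W_null \<psi>" "x = s + n"
      by (auto simp: elt_set_plus_def)
    have "x = t + ((s - t) + n)" by (simp add: n(2))
    then show "x \<in> t +o W_null \<psi>"
      using add [OF assms n(1)] by (simp only: set_plus_intro2)
  qed
  show "t +o W_null \<psi> \<subseteq> s +o W_null \<psi>"
  proof
    fix x assume "x \<in> t +o W_null \<psi>"
    then obtain n where n: "n \<in> W_null \<psi>" "x = t + n"
      by (auto simp: elt_set_plus_def)
    have "x = s + (- (s - t) + n)" by (simp add: n(2))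
    then show "x \<in> s +o W_null \<psi>"
      using add [OF diff n(1)] by (simp only: set_plus_intro2)
  qed
qed

lemma W_act_closed: "w \<in> W_carrier \<psi> \<Longrightarrow> W_act \<psi> u w \<in> W_carrier \<psi>"
  by (erule W_carrier_cases) (simp add: W_act_coset)

lemma W_add_closed: "w \<in> W_carrier \<psi> \<Longrightarrow> z \<in> W_carrier \<psi> \<Longrightarrow> w + z \<in> W_carrier \<psi>"
  by (elim W_carrier_cases) (simp add: add_subgroup_coset_plus add_subgroup_W_null)

lemma W_act_add:
  "w \<in> W_carrier \<psi> \<Longrightarrow> z \<in> W_carrier \<psi> \<Longrightarrow> W_act \<psi> u (w + z) = W_act \<psi> u w + W_act \<psi> u z"
  by (elim W_carrier_cases)
    (simp add: add_subgroup_coset_plus add_subgroup_W_null W_act_coset frag_extend_add)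

lemma W_act_one: "w \<in> W_carrier \<psi> \<Longrightarrow> W_act \<psi> 1 w = w"
proof (erule W_carrier_cases)
  fix t assume w: "w = t +o W_null \<psi>"
  have "frag_extend (\<lambda>(v, \<alpha>). frag_of (1 * v, \<alpha>)) t = t"
    by (induction t rule: frag_induction [OF subset_UNIV]) (auto simp: frag_extend_diff)
  then show ?thesis by (simp only: w W_act_coset)
qed

lemma W_act_mult: "w \<in> W_carrier \<psi> \<Longrightarrow> W_act \<psi> (u * v) w = W_act \<psi> u (W_act \<psi> v w)"
proof (erule W_carrier_cases)
  fix t assume w: "w = t +o W_null \<psi>"
  have "frag_extend (\<lambda>(x, \<alpha>). frag_of (u * v * x, \<alpha>)) t =
      frag_extend (\<lambda>(x, \<alpha>). frag_of (u * x, \<alpha>)) (frag_extend (\<lambda>(x, \<alpha>). frag_of (v * x, \<alpha>)) t)"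
    by (induction t rule: frag_induction [OF subset_UNIV])
      (auto simp: frag_extend_diff mult.assoc)
  then show ?thesis by (simp add: w W_act_coset)
qed

lemma W_act_add_scalar:
  "w \<in> W_carrier \<psi> \<Longrightarrow> W_act \<psi> (u + v) w = W_act \<psi> u w + W_act \<psi> v w"
proof (erule W_carrier_cases)
  fix t assume w: "w = t +o W_null \<psi>"
  let ?f = "\<lambda>u. frag_extend (\<lambda>(x, \<alpha>). frag_of (u * x, \<alpha>))"
  have "?f (u + v) t - (?f u t + ?f v t) \<in> W_null \<psi>"
  proof (induction t rule: frag_induction [OF subset_UNIV])
    case 1
    show ?case by (simp add: add_subgroupD [OF add_subgroup_W_null])
  next
    case (2 x)
    obtain y \<alpha> where x: "x = (y, \<alpha>)" by (cases x)
    have "frag_of (u * y + v * y, \<alpha>) - frag_of (u * y, \<alpha>) - frag_of (v * y, \<alpha>) \<in> W_null \<psi>"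
      unfolding W_null_def tensor_null_def by (rule hull_inc) blast
    then show ?case by (simp add: x distrib_right diff_diff_eq)
  next
    case (3 a b)
    then have "(?f (u + v) a - (?f u a + ?f v a)) + - (?f (u + v) b - (?f u b + ?f v b)) \<in> W_null \<psi>"
      using add_subgroup_W_null unfolding add_subgroup_def by blast
    then show ?case by (simp add: frag_extend_diff algebra_simps)
  qed
  then show ?thesis
    by (simp add: w W_act_coset add_subgroup_coset_plus add_subgroup_W_null W_coset_eqI)
qed

lemma L_null_subset: "L_null \<psi> \<xi> \<subseteq> W_carrier \<psi>"
  by (auto simp: L_null_def W_act_closed)

lemma L_null_add: "x \<in> L_null \<psi> \<xi> \<Longrightarrow> y \<in> L_null \<psi> \<xi> \<Longrightarrow> x + y \<in> L_null \<psi> \<xi>"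
  by (auto simp: L_null_def W_add_closed simp flip: W_act_add)

lemma W_null_in_L_null: "W_null \<psi> \<in> L_null \<psi> \<xi>"
proof -
  have "W_null \<psi> = W_act \<psi> (uea_of (sv_M 0) - \<xi> *\<^sub>C 1) (0 +o W_null \<psi>)"
    unfolding W_act_coset by (simp add: elt_set_plus_def)
  then show ?thesis
    unfolding L_null_def using W_carrier_coset by (rule image_eqI)
qed

lemma L_null_act:
  assumes "x \<in> L_null \<psi> \<xi>"
  shows "W_act \<psi> u x \<in> L_null \<psi> \<xi>"
proof -
  let ?m = "uea_of (sv_M 0) - \<xi> *\<^sub>C 1"
  obtain w where w: "w \<in> W_carrier \<psi>" and x: "x = W_act \<psi> ?m w"
    using assms by (auto simp: L_null_def)
  have "u * ?m = ?m * u"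
    using uea_of_central [OF sv_M0_central, of u] by (simp add: algebra_simps)
  then have "W_act \<psi> u x = W_act \<psi> ?m (W_act \<psi> u w)"
    using w by (simp only: x flip: W_act_mult)
  then show ?thesis
    using w by (auto simp: L_null_def W_act_closed)
qed

lemma L_act_coset:
  assumes "w \<in> W_carrier \<psi>"
  shows "L_act \<psi> \<xi> u (w +o L_null \<psi> \<xi>) = W_act \<psi> u w +o L_null \<psi> \<xi>"
proof
  have add: "W_act \<psi> u (w + x) = W_act \<psi> u w + W_act \<psi> u x" if "x \<in> L_null \<psi> \<xi>" for x
    using W_act_add assms that L_null_subset by blast
  show "L_act \<psi> \<xi> u (w +o L_null \<psi> \<xi>) \<subseteq> W_act \<psi> u w +o L_null \<psi> \<xi>"
  proof
    fix y assume "y \<in> L_act \<psi> \<xi> u (w +o L_null \<psi> \<xi>)"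
    then obtain x x' where x: "x \<in> L_null \<psi> \<xi>" "x' \<in> L_null \<psi> \<xi>"
      and y: "y = W_act \<psi> u (w + x) + x'"
      by (auto simp: L_act_def quotient_op_def elt_set_plus_def set_plus_def)
    have "y = W_act \<psi> u w + (W_act \<psi> u x + x')"
      by (simp only: y add [OF x(1)] add.assoc)
    then show "y \<in> W_act \<psi> u w +o L_null \<psi> \<xi>"
      using L_null_add [OF L_null_act [OF x(1)] x(2)] by (simp only: set_plus_intro2)
  qed
  obtain t where t: "w = t +o W_null \<psi>"
    using assms by (rule W_carrier_cases)
  have "w + W_null \<psi> = w"
    using add_subgroup_coset_plus [OF add_subgroup_W_null, of t \<psi> 0]
    by (simp add: t)
  then have "w \<in> w +o L_null \<psi> \<xi>"
    using set_plus_intro2 [OF W_null_in_L_null, of w] by metis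
  then show "W_act \<psi> u w +o L_null \<psi> \<xi> \<subseteq> L_act \<psi> \<xi> u (w +o L_null \<psi> \<xi>)"
    by (auto simp: L_act_def quotient_op_def elt_set_plus_def set_plus_def)
qed

lemma W_act_generator:
  assumes "lie_hom \<psi>"
  shows "W_act \<psi> (uea_of (sv_plus_incl x)) (W_generator \<psi>) = frag_of (1, \<psi> x) +o W_null \<psi>"
proof -
  have r: "uea_map sv_plus_incl (uea_of x) = uea_of (sv_plus_incl x)"
    by (simp add: uea_map_def uea_lift_of lie_hom_commutator_sv_plus)
  have l: "uea_lift \<psi> (uea_of x) = \<psi> x"
    using assms by (simp add: uea_lift_of lie_hom_complex_iff)
  have "frag_of (1 * uea_map sv_plus_incl (uea_of x), 1)
      - frag_of (1, uea_lift \<psi> (uea_of x) * 1) \<in> W_null \<psi>"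
    unfolding W_null_def tensor_null_def by (rule hull_inc) blast
  then show ?thesis
    by (simp add: r l W_generator_def W_act_coset W_coset_eqI)
qed

end

theory Submission
  imports Defs
begin

text \<open>
  Let \<open>I\<close> be the left ideal of all \<open>u \<in> U(sv)\<close> with \<open>u w = 0\<close>, where \<open>w\<close> is the generator of the
  Whittaker module. The module is \<open>U(sv) / I\<close>, so the vector \<open>v w\<close> is a Whittaker vector exactly
  if \<open>x v \<in> I\<close> for all \<open>x \<in> sv\<^sup>+\<close>, and the theorem says that such a \<open>v\<close> lies in \<open>\<complex>[L\<^sub>0] + I\<close>.
  The converse is the observation that each basis element of \<open>sv\<^sup>+\<close> is an eigenvector of
  \<open>ad L\<^sub>0\<close>, hence can be moved past \<open>\<complex>[L\<^sub>0]\<close> into \<open>I\<close>. The ideal \<open>I\<close>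
  enters through the elements of \<open>sv\<^sup>+\<close> and \<open>M\<^sub>0 - \<xi>\<close> that it contains; the locale
  \<open>highest_weight_ideal\<close> below captures this.

  Moving generators past each other shows that \<open>U(sv)\<close> is spanned by words

    \<open>L\<^bsub>-a\<^esub> \<dots> L\<^bsub>-a'\<^esub> Y\<^bsub>-b\<^esub> \<dots> Y\<^bsub>-b'\<^esub> M\<^bsub>-c\<^esub> \<dots> M\<^bsub>-c'\<^esub> f(L\<^sub>0)\<close>

  with letters of negative index, modulo \<open>I\<close>. The three kinds of letters are removed from a
  Whittaker vector one after the other, from left to right. In each case there is for every letter
  \<open>X\<close> an operator \<open>Z\<close> from \<open>sv\<^sup>+\<close> whose commutator with \<open>X\<close> is a nonzero multiple of \<open>M\<^sub>0\<close>, that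
  is, of \<open>\<xi>\<close>: \<open>Z = M\<^sub>n\<close> for \<open>X = L\<^bsub>-n\<^esub>\<close>, the mode of \<open>Y\<close> of opposite index for a mode of \<open>Y\<close>,
  and \<open>Z = L\<^sub>n\<close> for \<open>X = M\<^bsub>-n\<^esub>\<close>. This is where \<open>\<xi> \<noteq> 0\<close> enters. If \<open>X\<close> is the letter of largest
  index in \<open>v = \<Sum>\<^sub>k X\<^sup>k q\<^sub>k\<close>, then \<open>Z q\<^sub>k\<close> is negligible, and \<open>Z\<close> acts on \<open>v\<close> like \<open>\<xi>\<close> times the
  derivative by \<open>X\<close>; so \<open>Z v = 0\<close> forces \<open>v\<close> to be \<open>q\<^sub>0\<close>, without \<open>X\<close>. Descending over the index
  removes all letters of this kind.

  What is negligible depends on the letters. The elements \<open>M\<^bsub>-n\<^esub>\<close> commute, and there it means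
  membership in \<open>I\<close>. The letters \<open>L\<^bsub>-n\<^esub>\<close> and the modes of \<open>Y\<close> do not commute, and \<open>Z q\<^sub>k\<close> need not
  vanish; but reordering shortens words by at least one letter, \<open>Z\<close> shortens every word by at least one
  letter, and it shortens words without \<open>X\<close> and larger letters by at least two. Everything is then
  done modulo shorter words, with an induction on the length. The lemmas \<open>elimination\<close> and
  \<open>words_descent\<close> carry this argument.

  Coefficients are compared only modulo \<open>I\<close>: those that have to vanish are shown to lie in \<open>I\<close>.
  Hence it suffices that the words span.
\<close>

section \<open>Derivations along powers of a letter\<close>

text \<open>
  \<open>Z\<close> satisfies the product rule of \<open>\<kappa> d/dX\<close> modulo \<open>E\<close>. Moving \<open>Z\<close> to the right leaves errors
  only behind powers of \<open>X\<close>, and \<open>E\<close> absorbs these.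
\<close>

lemma commute_power:
  fixes X Z :: "'a::complex_algebra_1" and E :: "'a set"
  assumes E: "complex_vector.subspace E" and XE: "\<And>u. u \<in> E \<Longrightarrow> X * u \<in> E"
    and comm: "\<And>u. Z * (X * u) - X * (Z * u) - \<kappa> *\<^sub>C u \<in> E"
  shows "Z * (X ^ Suc k * q) - X ^ Suc k * (Z * q) - (of_nat (Suc k) * \<kappa>) *\<^sub>C (X ^ k * q) \<in> E"
proof (induction k)
  case 0
  show ?case using comm [of q] by simp
next
  case (Suc k)
  let ?e = "Z * (X ^ Suc k * q) - X ^ Suc k * (Z * q) - (of_nat (Suc k) * \<kappa>) *\<^sub>C (X ^ k * q)"
  let ?f = "Z * (X * (X ^ Suc k * q)) - X * (Z * (X ^ Suc k * q)) - \<kappa> *\<^sub>C (X ^ Suc k * q)"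
  have s: "(of_nat (Suc (Suc k)) * \<kappa>) *\<^sub>C (X ^ Suc k * q)
      = X * ((of_nat (Suc k) * \<kappa>) *\<^sub>C (X ^ k * q)) + \<kappa> *\<^sub>C (X ^ Suc k * q)"
  proof -
    have "of_nat (Suc (Suc k)) * \<kappa> = of_nat (Suc k) * \<kappa> + \<kappa>"
      by (simp add: distrib_right)
    then show ?thesis
      by (simp only: scaleC_add_left mult_scaleC_right power_Suc mult.assoc)
  qed
  have "Z * (X ^ Suc (Suc k) * q) - X ^ Suc (Suc k) * (Z * q)
      - (of_nat (Suc (Suc k)) * \<kappa>) *\<^sub>C (X ^ Suc k * q) = X * ?e + ?f"
    unfolding s by (simp add: mult.assoc right_diff_distrib del: of_nat_Suc)
  moreover have "X * ?e + ?f \<in> E"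
    by (intro complex_vector.subspace_add [OF E] XE Suc.IH comm)
  ultimately show ?case by simp
qed

lemma power_mult_raises:
  fixes X :: "'a::monoid_mult" and D :: "int \<Rightarrow> 'a set"
  assumes "\<And>s u. u \<in> D s \<Longrightarrow> X * u \<in> D (s + 1)" and "u \<in> D s"
  shows "X ^ k * u \<in> D (s + int k)"
proof (induction k)
  case 0
  then show ?case using assms(2) by simp
next
  case (Suc k)
  have "X * (X ^ k * u) \<in> D (s + int k + 1)" by (rule assms(1) [OF Suc])
  then show ?case by (simp only: power_Suc mult.assoc of_nat_Suc add_ac)
qed

text \<open>
  Think of \<open>D s\<close> as the elements of degree at most \<open>s\<close>. If \<open>Z\<close> lowers the coefficients \<open>q k\<close> by two
  degrees rather than one, then up to degree \<open>r - 2\<close> it acts on \<open>\<Sum>\<^sub>k X\<^sup>k q k\<close> as \<open>\<kappa> d/dX\<close> alone.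
  The induction on \<open>K\<close> differentiates: the polynomial with coefficients
  \<open>(k + 1) \<kappa> q (k + 1)\<close> satisfies the same hypotheses for \<open>r - 1\<close>, and its constant term is
  recovered from its value.
\<close>

lemma coefficients_lowered:
  fixes X Z :: "'a::complex_algebra_1" and D :: "int \<Rightarrow> 'a set"
  assumes D: "\<And>s. complex_vector.subspace (D s)"
    and XD: "\<And>s u. u \<in> D s \<Longrightarrow> X * u \<in> D (s + 1)"
    and ZD: "\<And>s u. u \<in> D s \<Longrightarrow> Z * u \<in> D (s - 1)"
    and comm: "\<And>s u. Z * (X * u) - X * (Z * u) - \<kappa> *\<^sub>C u \<in> D s" and "\<kappa> \<noteq> 0"
    and Zq: "\<And>k. k \<le> K \<Longrightarrow> Z * q k \<in> D (r - int k - 2)"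
    and v: "Z * (\<Sum>k\<le>K. X ^ k * q k) \<in> D (r - 2)"
  shows "\<forall>k\<in>{1..K}. q k \<in> D (r - 1 - int k)"
  using Zq v
proof (induction K arbitrary: q r)
  case 0
  show ?case by simp
next
  case (Suc K)
  \<comment> \<open>The errors of the commutation relation lie in every degree, so the product rule is used modulo their intersection.\<close>
  define E where "E = (\<Inter>s. D s)"
  have E: "complex_vector.subspace E"
    using D by (auto simp: E_def complex_vector.subspace_def)
  have XE: "X * u \<in> E" if "u \<in> E" for u
  proof -
    have "X * u \<in> D s" for s using XD [of u "s - 1"] that by (simp add: E_def)
    then show ?thesis by (simp add: E_def)
  qed
  have commE: "Z * (X * u) - X * (Z * u) - \<kappa> *\<^sub>C u \<in> E" for u
    using comm by (simp add: E_def)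
  have XkD: "X ^ k * u \<in> D (s + int k)" if "u \<in> D s" for k u s
    by (rule power_mult_raises [where D = D]) (use XD that in auto)
  \<comment> \<open>The coefficients of the derivative.\<close>
  define p where "p k = (of_nat (Suc k) * \<kappa>) *\<^sub>C q (Suc k)" for k
  let ?v' = "\<Sum>k\<le>K. X ^ k * p k"
  let ?e = "\<lambda>k. Z * (X ^ Suc k * q (Suc k)) - X ^ Suc k * (Z * q (Suc k)) - X ^ k * p k"
  have e: "?e k \<in> D (r - 2)" for k
    using commute_power [OF E XE commE, of k "q (Suc k)"] by (simp add: p_def E_def)
  have low: "X ^ k * (Z * q k) \<in> D (r - 2)" if "k \<le> Suc K" for k
    using XkD [OF Suc.prems(1) [OF that], of k] by simp
  have "(\<Sum>k\<le>Suc K. X ^ k * q k) = q 0 + (\<Sum>k\<le>K. X ^ Suc k * q (Suc k))"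
    by (subst sum.atMost_Suc_shift) simp
  then have "?v' = Z * (\<Sum>k\<le>Suc K. X ^ k * q k) - Z * q 0
      - (\<Sum>k\<le>K. ?e k) - (\<Sum>k\<le>K. X ^ Suc k * (Z * q (Suc k)))"
    by (simp only: distrib_left sum_distrib_left sum_subtractf) (simp del: power_Suc)
  moreover have "Z * q 0 \<in> D (r - 2)"
    using low [of 0] by simp
  moreover have "(\<Sum>k\<le>K. ?e k) \<in> D (r - 2)"
    by (intro complex_vector.subspace_sum [OF D] e)
  moreover have "(\<Sum>k\<le>K. X ^ Suc k * (Z * q (Suc k))) \<in> D (r - 2)"
    by (intro complex_vector.subspace_sum [OF D] low) simp
  ultimately have v': "?v' \<in> D (r - 2)"
    using Suc.prems(2) by (auto intro!: complex_vector.subspace_diff [OF D])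
  have Zp: "Z * p k \<in> D (r - 1 - int k - 2)" if "k \<le> K" for k
  proof -
    have "r - int (Suc k) - 2 = r - 1 - int k - 2" by simp
    then show ?thesis
      using complex_vector.subspace_scale [OF D Suc.prems(1) [of "Suc k"]] that
      by (simp add: p_def)
  qed
  have IH: "p k \<in> D (r - 1 - 1 - int k)" if "1 \<le> k" "k \<le> K" for k
    using Suc.IH [OF Zp] ZD [OF v'] that by simp
  have p: "p k \<in> D (r - 2 - int k)" if "k \<le> K" for k
  proof (cases "k = 0")
    case False
    then show ?thesis using IH [of k] that by simp
  next
    case True
    have sp: "?v' = p 0 + (\<Sum>k\<in>{1..K}. X ^ k * p k)"
      by (simp add: sum.atLeast1_atMost_eq sum.atMost_shift)
    have "(\<Sum>k\<in>{1..K}. X ^ k * p k) \<in> D (r - 2)"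
    proof (rule complex_vector.subspace_sum [OF D])
      fix k assume "k \<in> {1..K}"
      then show "X ^ k * p k \<in> D (r - 2)"
        using XkD [OF IH [of k], of k] by simp
    qed
    from complex_vector.subspace_diff [OF D v' this] show ?thesis
      using True by (simp add: sp)
  qed
  have "q (Suc j) \<in> D (r - 2 - int j)" if "j \<le> K" for j
  proof -
    have "of_nat (Suc j) * \<kappa> \<noteq> 0"
      using \<open>\<kappa> \<noteq> 0\<close> by (simp del: of_nat_Suc)
    then have "q (Suc j) = inverse (of_nat (Suc j) * \<kappa>) *\<^sub>C p j"
      by (simp only: p_def scaleC_scaleC field_class.field_inverse scaleC_one simp_thms)
    then show ?thesis
      using complex_vector.subspace_scale [OF D p [OF that]] by simp
  qed
  then have "q k \<in> D (r - 1 - int k)" if "1 \<le> k" "k \<le> Suc K" for k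
    using that by (cases k) (auto simp: algebra_simps)
  then show ?case by simp
qed

section \<open>Words in a family of letters\<close>

text \<open>
  Linear combinations of products of at most \<open>r\<close> letters \<open>x a\<close>, \<open>a \<in> A\<close>, with an element of \<open>S\<close>
  at the right end. Closure under linear combinations is part of the induction, so that properties
  stable under them can be proved by one rule induction.
\<close>

inductive word_span ::
    "(int \<Rightarrow> 'a::complex_algebra_1) \<Rightarrow> int set \<Rightarrow> 'a set \<Rightarrow> nat \<Rightarrow> 'a \<Rightarrow> bool"
  for x A S where
    base: "u \<in> S \<Longrightarrow> word_span x A S r u"
  | letter: "word_span x A S r u \<Longrightarrow> a \<in> A \<Longrightarrow> word_span x A S (Suc r) (x a * u)"
  | add: "word_span x A S r u \<Longrightarrow> word_span x A S r v \<Longrightarrow> word_span x A S r (u + v)"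
  | scale: "word_span x A S r u \<Longrightarrow> word_span x A S r (c *\<^sub>C u)"

lemma word_span_Suc: "word_span x A S r u \<Longrightarrow> word_span x A S (Suc r) u"
  by (induction rule: word_span.induct) (auto intro: word_span.intros)

lemma word_span_mono_length: "r \<le> r' \<Longrightarrow> word_span x A S r u \<Longrightarrow> word_span x A S r' u"
  by (induction rule: dec_induct) (auto intro: word_span_Suc)

lemma word_span_mono_letters: "word_span x A S r u \<Longrightarrow> A \<subseteq> B \<Longrightarrow> word_span x B S r u"
  by (induction rule: word_span.induct) (auto intro: word_span.intros)

lemma subspace_word_span:
  "complex_vector.subspace S \<Longrightarrow> complex_vector.subspace {u. word_span x A S r u}"
  by (auto simp: complex_vector.subspace_def intro: word_span.intros)

lemma subspace_word_span_Union:
  assumes "complex_vector.subspace S"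
  shows "complex_vector.subspace {u. \<exists>r. word_span x A S r u}"
proof -
  have "\<exists>r. word_span x A S r (u + v)" if "word_span x A S r u" "word_span x A S r' v" for u v r r'
    using that word_span_mono_length [of r "max r r'"] word_span_mono_length [of r' "max r r'"]
    by (auto intro!: exI [of _ "max r r'"] word_span.add)
  then show ?thesis
    using assms by (auto simp: complex_vector.subspace_def intro: word_span.intros)
qed

lemma word_span_no_letters:
  "word_span x {} S r u \<Longrightarrow> complex_vector.subspace S \<Longrightarrow> u \<in> S"
  by (induction rule: word_span.induct)
    (auto intro: complex_vector.subspace_add complex_vector.subspace_scale)

lemma word_span_finitely_many_letters:
  "word_span x {1..} S r u \<Longrightarrow> \<exists>N::nat. word_span x {1..int N} S r u"
proof (induction rule: word_span.induct)
  case (base u r)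
  then show ?case by (auto intro: word_span.base)
next
  case (letter r u a)
  then obtain N where "word_span x {1..int N} S r u" by blast
  then have "word_span x {1..int (max N (nat a))} S r u"
    by (rule word_span_mono_letters) auto
  moreover have "a \<in> {1..int (max N (nat a))}" using letter by auto
  ultimately show ?case by (blast intro: word_span.letter)
next
  case (add r u v)
  then obtain N N' where "word_span x {1..int N} S r u" "word_span x {1..int N'} S r v" by blast
  then have "word_span x {1..int (max N N')} S r u" "word_span x {1..int (max N N')} S r v"
    by (auto elim!: word_span_mono_letters)
  then show ?case by (blast intro: word_span.add)
next
  case (scale r u c)
  then show ?case by (blast intro: word_span.scale)
qed

lemma word_span_power:
  assumes "n \<in> A" "word_span x A S r u"
  shows "word_span x A S (k + r) (x n ^ k * u)"
proof (induction k)
  case 0 then show ?case using assms by simp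
next
  case (Suc k)
  then show ?case using word_span.letter [OF Suc assms(1)] by (simp add: mult.assoc)
qed

text \<open>Each transposition of \<open>x a\<close> with a factor \<open>x n\<close> costs an error of one degree less.\<close>

lemma move_past_power:
  fixes x :: "int \<Rightarrow> 'a::complex_algebra_1" and D :: "int \<Rightarrow> 'a set"
  assumes D: "\<And>s. complex_vector.subspace (D s)"
    and XD: "\<And>s u. u \<in> D s \<Longrightarrow> x n * u \<in> D (s + 1)"
    and comm: "\<And>r u. word_span x A S r u \<Longrightarrow> x a * (x n * u) - x n * (x a * u) \<in> D (int r + 1)"
    and n: "n \<in> A" and q: "word_span x A S r q"
  shows "x a * (x n ^ k * q) - x n ^ k * (x a * q) \<in> D (int (k + r))"
proof (induction k)
  case 0
  show ?case using complex_vector.subspace_0 [OF D] by simp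
next
  case (Suc k)
  let ?u = "x n ^ k * q"
  have "x n * (x a * ?u - x n ^ k * (x a * q)) \<in> D (int (Suc k + r))"
    using XD [OF Suc] by (simp add: add.commute)
  moreover have "x a * (x n * ?u) - x n * (x a * ?u) \<in> D (int (Suc k + r))"
    using comm [OF word_span_power [OF n q, of k]] by (simp add: add.commute)
  ultimately have "x n * (x a * ?u - x n ^ k * (x a * q)) + (x a * (x n * ?u) - x n * (x a * ?u))
      \<in> D (int (Suc k + r))"
    by (rule complex_vector.subspace_add [OF D])
  then show ?case by (simp add: right_diff_distrib mult.assoc)
qed

text \<open>Modulo shorter words, all occurrences of the letter of largest index can be collected at the left end.\<close>

lemma word_span_expand:
  fixes x :: "int \<Rightarrow> 'a::complex_algebra_1" and D :: "int \<Rightarrow> 'a set"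
  defines "X N \<equiv> x (int (Suc N))"
  assumes S: "complex_vector.subspace S"
    and D: "\<And>s. complex_vector.subspace (D s)"
    and xD: "\<And>a s u. 1 \<le> a \<Longrightarrow> u \<in> D s \<Longrightarrow> x a * u \<in> D (s + 1)"
    and comm: "\<And>a b r u. 1 \<le> a \<Longrightarrow> 1 \<le> b \<Longrightarrow> word_span x {1..} S r u \<Longrightarrow>
       x a * (x b * u) - x b * (x a * u) \<in> D (int r + 1)"
    and u: "word_span x {1..int (Suc N)} S r u"
  shows "\<exists>q. (\<forall>k\<le>r. word_span x {1..int N} S (r - k) (q k)) \<and>
     u - (\<Sum>k\<le>r. X N ^ k * q k) \<in> D (int r - 1)"
  using u
proof (induction rule: word_span.induct)
  case (base u r)
  define q where "q k = (if k = 0 then u else 0)" for k :: nat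
  have "(\<Sum>k\<le>r. X N ^ k * q k) = (\<Sum>k\<le>r. if k = 0 then u else 0)"
    by (rule sum.cong) (auto simp: q_def)
  then have "u - (\<Sum>k\<le>r. X N ^ k * q k) \<in> D (int r - 1)"
    using complex_vector.subspace_0 [OF D] by simp
  moreover have "\<forall>k\<le>r. word_span x {1..int N} S (r - k) (q k)"
    using base complex_vector.subspace_0 [OF S] by (auto simp: q_def intro: word_span.base)
  ultimately show ?case by blast
next
  case (letter r u a)
  then obtain q where q: "\<And>k. k \<le> r \<Longrightarrow> word_span x {1..int N} S (r - k) (q k)"
    and d: "u - (\<Sum>k\<le>r. X N ^ k * q k) \<in> D (int r - 1)" (is "?d \<in> _") by blast
  have zero: "word_span x {1..int N} S r 0" for r
    using complex_vector.subspace_0 [OF S] by (rule word_span.base)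
  have xd: "x a * ?d \<in> D (int (Suc r) - 1)"
    using xD [OF _ d, of a] letter(2) by simp
  show ?case
  proof (cases "a = int (Suc N)")
    case True
    define p where "p k = (case k of 0 \<Rightarrow> 0 | Suc k \<Rightarrow> q k)" for k
    have "(\<Sum>k\<le>Suc r. X N ^ k * p k) = x a * (\<Sum>k\<le>r. X N ^ k * q k)"
      by (subst sum.atMost_Suc_shift) (simp add: p_def sum_distrib_left mult.assoc X_def True)
    then have "x a * u - (\<Sum>k\<le>Suc r. X N ^ k * p k) \<in> D (int (Suc r) - 1)"
      using xd by (simp add: right_diff_distrib)
    moreover have "\<forall>k\<le>Suc r. word_span x {1..int N} S (Suc r - k) (p k)"
      using q zero by (auto simp: p_def split: nat.split)
    ultimately show ?thesis by blast
  next
    case False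
    then have a: "a \<in> {1..int N}" using letter(2) by auto
    define p where "p k = (if k \<le> r then x a * q k else 0)" for k
    let ?e = "\<lambda>k. x a * (X N ^ k * q k) - X N ^ k * (x a * q k)"
    have "?e k \<in> D (int (Suc r) - 1)" if "k \<le> r" for k
    proof -
      have "word_span x {1..} S (r - k) (q k)"
        using q [OF that] by (rule word_span_mono_letters) auto
      then have "?e k \<in> D (int (k + (r - k)))"
        unfolding X_def by (intro move_past_power [where A = "{1..}" and S = S] D xD comm) (use a in auto)
      then show ?thesis using that by simp
    qed
    then have e: "(\<Sum>k\<le>r. ?e k) \<in> D (int (Suc r) - 1)"
      by (intro complex_vector.subspace_sum [OF D]) auto
    have eq: "x a * u - (\<Sum>k\<le>Suc r. X N ^ k * p k) = x a * ?d + (\<Sum>k\<le>r. ?e k)"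
    proof -
      have "(\<Sum>k\<le>Suc r. X N ^ k * p k) = (\<Sum>k\<le>r. X N ^ k * (x a * q k))"
        by (simp add: p_def)
      then show ?thesis
        by (simp only: right_diff_distrib sum_distrib_left sum_subtractf) simp
    qed
    have "x a * u - (\<Sum>k\<le>Suc r. X N ^ k * p k) \<in> D (int (Suc r) - 1)"
      unfolding eq by (rule complex_vector.subspace_add [OF D xd e])
    moreover have "word_span x {1..int N} S (Suc r - k) (p k)" if "k \<le> Suc r" for k
      using word_span.letter [OF q a, of k] zero that by (auto simp: p_def Suc_diff_le)
    ultimately show ?thesis by (intro exI [of _ p]) simp
  qed
next
  case (add r u v)
  then obtain q q' where q: "\<forall>k\<le>r. word_span x {1..int N} S (r - k) (q k)"
      "u - (\<Sum>k\<le>r. X N ^ k * q k) \<in> D (int r - 1)"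
    and q': "\<forall>k\<le>r. word_span x {1..int N} S (r - k) (q' k)"
      "v - (\<Sum>k\<le>r. X N ^ k * q' k) \<in> D (int r - 1)" by blast
  have "(u + v) - (\<Sum>k\<le>r. X N ^ k * (q k + q' k))
      = (u - (\<Sum>k\<le>r. X N ^ k * q k)) + (v - (\<Sum>k\<le>r. X N ^ k * q' k))"
    by (simp only: distrib_left sum.distrib add_diff_add)
  also have "\<dots> \<in> D (int r - 1)"
    by (rule complex_vector.subspace_add [OF D q(2) q'(2)])
  finally show ?case
    using q(1) q'(1) by (intro exI [of _ "\<lambda>k. q k + q' k"]) (simp add: word_span.add)
next
  case (scale r u c)
  then obtain q where q: "\<forall>k\<le>r. word_span x {1..int N} S (r - k) (q k)"
    "u - (\<Sum>k\<le>r. X N ^ k * q k) \<in> D (int r - 1)" by blast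
  have "c *\<^sub>C u - (\<Sum>k\<le>r. X N ^ k * (c *\<^sub>C q k)) = c *\<^sub>C (u - (\<Sum>k\<le>r. X N ^ k * q k))"
    by (simp add: complex_vector.scale_right_diff_distrib complex_vector.scale_sum_right)
  also have "\<dots> \<in> D (int r - 1)"
    by (rule complex_vector.subspace_scale [OF D q(2)])
  finally show ?case
    using q(1) by (intro exI [of _ "\<lambda>k. c *\<^sub>C q k"]) (simp add: word_span.scale)
qed

text \<open>
  The main step. The hypothesis \<open>zq\<close> is the one that makes the order of elimination matter: the
  operator \<open>z n\<close> is required to lower the degree by two only on words in letters before \<open>x n\<close>.
  So the last letter has to be removed first, and then \<open>z\<close> still annihilates the rest up to the
  same error. The family \<open>D\<close> is left open because it is the filtration by length in two
  applications and constant in the third.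
\<close>

lemma elimination:
  fixes x z :: "int \<Rightarrow> 'a::complex_algebra_1" and D :: "int \<Rightarrow> 'a set" and \<kappa> :: "int \<Rightarrow> complex"
  assumes S: "complex_vector.subspace S"
    and D: "\<And>s. complex_vector.subspace (D s)"
    and xD: "\<And>a s u. 1 \<le> a \<Longrightarrow> u \<in> D s \<Longrightarrow> x a * u \<in> D (s + 1)"
    and zD: "\<And>n s u. 1 \<le> n \<Longrightarrow> u \<in> D s \<Longrightarrow> z n * u \<in> D (s - 1)"
    and xx: "\<And>a b r u. 1 \<le> a \<Longrightarrow> 1 \<le> b \<Longrightarrow> word_span x {1..} S r u \<Longrightarrow>
       x a * (x b * u) - x b * (x a * u) \<in> D (int r + 1)"
    and zx: "\<And>n s u. 1 \<le> n \<Longrightarrow> z n * (x n * u) - x n * (z n * u) - \<kappa> n *\<^sub>C u \<in> D s"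
    and \<kappa>: "\<And>n. 1 \<le> n \<Longrightarrow> \<kappa> n \<noteq> 0"
    and zq: "\<And>n r u. 1 \<le> n \<Longrightarrow> word_span x {1..n - 1} S r u \<Longrightarrow> z n * u \<in> D (int r - 2)"
    and v: "word_span x {1..} S r v" and zv: "\<And>n. 1 \<le> n \<Longrightarrow> z n * v \<in> D (int r - 2)"
  shows "\<exists>s\<in>S. v - s \<in> D (int r - 1)"
proof -
  have step: "\<exists>q. word_span x {1..int N} S r q \<and> v - q \<in> D (int r - 1)"
    if v: "word_span x {1..int (Suc N)} S r v" and zv: "z (int (Suc N)) * v \<in> D (int r - 2)" for N v
  proof -
    let ?n = "int (Suc N)"
    let ?X = "x ?n" and ?Z = "z ?n"
    obtain q where q: "\<And>k. k \<le> r \<Longrightarrow> word_span x {1..int N} S (r - k) (q k)"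
      and d: "v - (\<Sum>k\<le>r. ?X ^ k * q k) \<in> D (int r - 1)" (is "v - ?v \<in> _")
      using word_span_expand [where x = x and D = D, OF S D xD xx v] by blast
    have "?Z * (v - ?v) \<in> D (int r - 2)"
      using zD [OF _ d, of ?n] by simp
    then have "?Z * ?v \<in> D (int r - 2)"
      using complex_vector.subspace_diff [OF D zv] by (fastforce simp: right_diff_distrib)
    moreover have "?Z * q k \<in> D (int r - int k - 2)" if "k \<le> r" for k
      using zq [of ?n "r - k" "q k"] q [OF that] that by (simp add: of_nat_diff)
    ultimately have low: "q k \<in> D (int r - 1 - int k)" if "1 \<le> k" "k \<le> r" for k
      using that coefficients_lowered [of D ?X ?Z "\<kappa> ?n" r q "int r"] D xD zD zx \<kappa> by simp
    have "?X ^ k * q k \<in> D (int r - 1)" if "k \<in> {1..r}" for k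
    proof -
      have "?X ^ k * q k \<in> D ((int r - 1 - int k) + int k)"
        by (rule power_mult_raises [where D = D]) (use xD [of ?n] low [of k] that in auto)
      then show ?thesis by simp
    qed
    then have low': "(\<Sum>k\<in>{1..r}. ?X ^ k * q k) \<in> D (int r - 1)"
      by (rule complex_vector.subspace_sum [OF D])
    have eq: "v - q 0 = (v - ?v) + (\<Sum>k\<in>{1..r}. ?X ^ k * q k)"
      by (simp add: sum.atLeast1_atMost_eq sum.atMost_shift)
    have "v - q 0 \<in> D (int r - 1)"
      unfolding eq by (rule complex_vector.subspace_add [OF D d low'])
    then show ?thesis using q [of 0] by auto
  qed
  have "\<exists>q. word_span x {1..int 0} S r q \<and> v - q \<in> D (int r - 1)"
    if "word_span x {1..int N} S r v" "\<And>n. 1 \<le> n \<Longrightarrow> z n * v \<in> D (int r - 2)" for N v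
    using that
  proof (induction N arbitrary: v)
    case 0
    then show ?case using complex_vector.subspace_0 [OF D] by (intro exI [of _ v]) simp
  next
    case (Suc N)
    obtain q where q: "word_span x {1..int N} S r q" and d: "v - q \<in> D (int r - 1)"
      using step [OF Suc.prems(1) Suc.prems(2)] by auto
    have "z n * q \<in> D (int r - 2)" if n: "1 \<le> n" for n
    proof -
      have "z n * (v - q) \<in> D (int r - 2)" using zD [OF n d] by simp
      from complex_vector.subspace_diff [OF D Suc.prems(2) [OF n] this]
      show ?thesis by (simp add: right_diff_distrib)
    qed
    then obtain q' where "word_span x {1..int 0} S r q'" and d': "q - q' \<in> D (int r - 1)"
      using Suc.IH [OF q] by blast
    moreover have "v - q' \<in> D (int r - 1)"
      using complex_vector.subspace_add [OF D d d'] by simp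
    ultimately show ?case by blast
  qed
  moreover obtain N :: nat where "word_span x {1..int N} S r v"
    using word_span_finitely_many_letters [OF v] by blast
  ultimately obtain q where "word_span x {1..int 0} S r q" "v - q \<in> D (int r - 1)"
    using zv by blast
  then show ?thesis using word_span_no_letters [OF _ S] by auto
qed

section \<open>Words of bounded length\<close>

definition words :: "(int \<Rightarrow> 'a::complex_algebra_1) \<Rightarrow> 'a set \<Rightarrow> 'a set" where
  "words x S = {u. \<exists>r. word_span x {1..} S r u}"

lemma subspace_words: "complex_vector.subspace S \<Longrightarrow> complex_vector.subspace (words x S)"
  unfolding words_def by (rule subspace_word_span_Union)

lemma words_base: "u \<in> S \<Longrightarrow> u \<in> words x S"
  by (auto simp: words_def intro: word_span.base)

lemma words_letter: "u \<in> words x S \<Longrightarrow> 1 \<le> a \<Longrightarrow> x a * u \<in> words x S"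
  by (auto simp: words_def intro: word_span.letter)

lemma word_span_words: "word_span x A S r u \<Longrightarrow> A \<subseteq> {1..} \<Longrightarrow> u \<in> words x S"
  by (auto simp: words_def intro: word_span_mono_letters)

lemma mult_word_span:
  fixes x :: "int \<Rightarrow> 'a::complex_algebra_1" and z :: "'k \<Rightarrow> 'a"
  assumes T: "\<And>r. complex_vector.subspace (T r)"
    and base: "\<And>r s k. s \<in> S \<Longrightarrow> k \<in> K \<Longrightarrow> z k * s \<in> T r"
    and letter: "\<And>r u a k. word_span x A S r u \<Longrightarrow> (\<And>k. k \<in> K \<Longrightarrow> z k * u \<in> T r) \<Longrightarrow>
       a \<in> A \<Longrightarrow> k \<in> K \<Longrightarrow> z k * (x a * u) \<in> T (Suc r)"
    and u: "word_span x A S r u" and k: "k \<in> K"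
  shows "z k * u \<in> T r"
proof -
  have "\<forall>k\<in>K. z k * u \<in> T r"
    using u
  proof (induction rule: word_span.induct)
    case (base u r)
    then show ?case by (simp add: assms(2))
  next
    case (letter r u a)
    then show ?case by (simp add: assms(3))
  next
    case (add r u v)
    then show ?case by (simp add: distrib_left complex_vector.subspace_add [OF T])
  next
    case (scale r u c)
    then show ?case by (simp add: complex_vector.subspace_scale [OF T])
  qed
  then show ?thesis using k by blast
qed

lemma mult_words:
  fixes x :: "int \<Rightarrow> 'a::complex_algebra_1" and z :: "'k \<Rightarrow> 'a"
  assumes W: "W = words x S" and T: "complex_vector.subspace T"
    and base: "\<And>s k. s \<in> S \<Longrightarrow> k \<in> K \<Longrightarrow> z k * s \<in> T"
    and letter: "\<And>u a k. u \<in> W \<Longrightarrow> (\<And>k. k \<in> K \<Longrightarrow> z k * u \<in> T) \<Longrightarrow>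
       1 \<le> a \<Longrightarrow> k \<in> K \<Longrightarrow> z k * (x a * u) \<in> T"
    and u: "u \<in> W" and k: "k \<in> K"
  shows "z k * u \<in> T"
proof -
  obtain r where "word_span x {1..} S r u" using u by (auto simp: W words_def)
  then show ?thesis
  proof (rule mult_word_span [where T = "\<lambda>_. T" and K = K, rotated 3])
    fix r u k and a :: int
    assume "word_span x {1..} S r u" "\<And>k. k \<in> K \<Longrightarrow> z k * u \<in> T" "a \<in> {1..}" "k \<in> K"
    then show "z k * (x a * u) \<in> T"
      by (intro letter) (auto simp: W words_def)
  qed (simp_all add: T base k)
qed

text \<open>
  The filtration by length, continued to negative degrees by the ideal \<open>I\<close>: operators that shorten
  words send the words of length zero there.
\<close>

definition words_upto :: "(int \<Rightarrow> 'a::complex_algebra_1) \<Rightarrow> 'a set \<Rightarrow> 'a set \<Rightarrow> int \<Rightarrow> 'a set" where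
  "words_upto x I S s = (if s < 0 then I else {u. word_span x {1..} S (nat s) u})"

lemma words_upto_of_nat: "u \<in> words_upto x I S (int r) \<longleftrightarrow> word_span x {1..} S r u"
  by (simp add: words_upto_def)

lemma subspace_words_upto:
  "complex_vector.subspace I \<Longrightarrow> complex_vector.subspace S \<Longrightarrow>
     complex_vector.subspace (words_upto x I S s)"
  by (simp add: words_upto_def subspace_word_span)

lemma ideal_subset_words_upto: "I \<subseteq> S \<Longrightarrow> u \<in> I \<Longrightarrow> u \<in> words_upto x I S s"
  by (auto simp: words_upto_def intro: word_span.base)

lemma words_upto_letter:
  assumes "I \<subseteq> S" and "\<And>u v. v \<in> I \<Longrightarrow> u * v \<in> I" and "1 \<le> a" and "u \<in> words_upto x I S s"
  shows "x a * u \<in> words_upto x I S (s + 1)"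
proof (cases "s < 0")
  case True
  then show ?thesis using assms by (auto simp: words_upto_def intro: word_span.base)
next
  case False
  then obtain r where s: "s = int r" by (metis nonneg_int_cases not_less)
  have "word_span x {1..} S (Suc r) (x a * u)"
    using assms(3,4) by (auto simp: s words_upto_of_nat intro: word_span.letter)
  then show ?thesis
    using words_upto_of_nat [of "x a * u" x I S "Suc r"] by (simp add: s add.commute)
qed

lemma words_upto_mono:
  assumes "u \<in> words_upto x I S s" and "I \<subseteq> S" and "s \<le> t"
  shows "u \<in> words_upto x I S t"
  using assms
  by (auto simp: words_upto_def intro: word_span.base word_span_mono_length [of "nat s"]
      split: if_splits)

text \<open>
  A family of operators has degree \<open>d \<le> 0\<close> for the filtration as soon as this holds on \<open>S\<close> and the
  commutators with letters, which may involve other members of the family, behave accordingly.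
\<close>

lemma mult_words_upto:
  fixes x :: "int \<Rightarrow> 'a::complex_algebra_1" and z :: "'k \<Rightarrow> 'a"
  assumes I: "complex_vector.subspace I" "I \<subseteq> S" "\<And>u v. v \<in> I \<Longrightarrow> u * v \<in> I"
    and S: "complex_vector.subspace S"
    and base: "\<And>s k. s \<in> S \<Longrightarrow> k \<in> K \<Longrightarrow> z k * s \<in> words_upto x I S d"
    and d: "d \<le> 0"
    and letter: "\<And>r u a k. word_span x {1..} S r u \<Longrightarrow>
       (\<And>k. k \<in> K \<Longrightarrow> z k * u \<in> words_upto x I S (int r + d)) \<Longrightarrow>
       1 \<le> a \<Longrightarrow> k \<in> K \<Longrightarrow> z k * (x a * u) - x a * (z k * u) \<in> words_upto x I S (int r + 1 + d)"
    and u: "u \<in> words_upto x I S s" and k: "k \<in> K"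
  shows "z k * u \<in> words_upto x I S (s + d)"
proof (cases "s < 0")
  case True
  then show ?thesis using u I(3) d by (simp add: words_upto_def)
next
  case False
  then obtain r where s: "s = int r" by (metis nonneg_int_cases not_less)
  have "word_span x {1..} S r u" using u by (simp add: s words_upto_of_nat)
  then show ?thesis
    unfolding s
  proof (rule mult_word_span [where T = "\<lambda>r. words_upto x I S (int r + d)" and K = K, rotated 3])
    fix r u k and a :: int
    assume *: "word_span x {1..} S r u" "\<And>k. k \<in> K \<Longrightarrow> z k * u \<in> words_upto x I S (int r + d)"
      "a \<in> {1..}" "k \<in> K"
    have "x a * (z k * u) \<in> words_upto x I S (int r + 1 + d)"
      using words_upto_letter [OF I(2,3) _ *(2) [OF *(4)], of a] *(3)
      by (simp add: add_ac)
    then have "x a * (z k * u) + (z k * (x a * u) - x a * (z k * u)) \<in> words_upto x I S (int r + 1 + d)"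
      using letter [OF *(1,2) _ *(4), of a] *(3)
      by (intro complex_vector.subspace_add [OF subspace_words_upto [OF I(1) S]]) auto
    then show "z k * (x a * u) \<in> words_upto x I S (int (Suc r) + d)"
      by (simp add: add_ac)
  next
    fix r s k assume "s \<in> S" "k \<in> K"
    then show "z k * s \<in> words_upto x I S (int r + d)"
      using words_upto_mono [OF base I(2), of s k "int r + d"] by simp
  qed (simp_all add: k subspace_words_upto [OF I(1) S])
qed

text \<open>
  Since \<open>S\<close> is contained in every filtration step of nonnegative degree, elimination says that an
  element of length at most \<open>r + 1\<close> that all \<open>z n\<close> send into \<open>I\<close> has length at most \<open>r\<close>.
\<close>

lemma words_descent:
  fixes x z :: "int \<Rightarrow> 'a::complex_algebra_1" and \<kappa> :: "int \<Rightarrow> complex"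
  defines "D \<equiv> words_upto x"
  assumes I: "complex_vector.subspace I" "I \<subseteq> S" "\<And>u v. v \<in> I \<Longrightarrow> u * v \<in> I"
    and S: "complex_vector.subspace S"
    and zD: "\<And>n s u. 1 \<le> n \<Longrightarrow> u \<in> D I S s \<Longrightarrow> z n * u \<in> D I S (s - 1)"
    and xx: "\<And>a b r u. 1 \<le> a \<Longrightarrow> 1 \<le> b \<Longrightarrow> word_span x {1..} S r u \<Longrightarrow>
       x a * (x b * u) - x b * (x a * u) \<in> D I S (int r + 1)"
    and zx: "\<And>n u. 1 \<le> n \<Longrightarrow> z n * (x n * u) - x n * (z n * u) - \<kappa> n *\<^sub>C u \<in> I"
    and \<kappa>: "\<And>n. 1 \<le> n \<Longrightarrow> \<kappa> n \<noteq> 0"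
    and zq: "\<And>n r u. 1 \<le> n \<Longrightarrow> word_span x {1..n - 1} S r u \<Longrightarrow> z n * u \<in> D I S (int r - 2)"
    and v: "v \<in> words x S" and zv: "\<And>n. 1 \<le> n \<Longrightarrow> z n * v \<in> I"
  shows "v \<in> S"
proof -
  obtain r where "word_span x {1..} S r v" using v by (auto simp: words_def)
  then show ?thesis
  proof (induction r)
    case 0
    then show ?case
    proof (induction "0::nat" v rule: word_span.induct)
    qed (auto intro: complex_vector.subspace_add [OF S] complex_vector.subspace_scale [OF S])
  next
    case (Suc r)
    have "\<exists>s\<in>S. v - s \<in> D I S (int (Suc r) - 1)"
    proof (rule elimination [OF S _ _ zD xx _ \<kappa> zq Suc.prems])
      show "complex_vector.subspace (D I S s)" for s
        unfolding D_def by (rule subspace_words_upto [OF I(1) S])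
      show "1 \<le> a \<Longrightarrow> u \<in> D I S s \<Longrightarrow> x a * u \<in> D I S (s + 1)" for a s u
        unfolding D_def by (rule words_upto_letter [OF I(2,3)])
    qed (use zx zv ideal_subset_words_upto [OF I(2)] in \<open>auto simp: D_def\<close>)
    then obtain s where s: "s \<in> S" "word_span x {1..} S r (v - s)"
      by (auto simp: D_def words_upto_of_nat)
    have "word_span x {1..} S r ((v - s) + s)"
      using s by (blast intro: word_span.intros)
    then show ?case using Suc.IH by simp
  qed
qed

section \<open>Commutation rules in the enveloping algebra\<close>

abbreviation UL :: "int \<Rightarrow> sv uea" where "UL n \<equiv> uea_of (sv_L n)"
abbreviation UM :: "int \<Rightarrow> sv uea" where "UM n \<equiv> uea_of (sv_M n)"
abbreviation UY :: "int \<Rightarrow> sv uea" where "UY n \<equiv> uea_of (sv_Y n)"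

lemma uea_of_swap:
  "uea_of a * (uea_of b * u) = uea_of b * (uea_of a * u) + uea_of (lie_bracket a b) * u"
  using arg_cong [OF uea_of_commutator [of a b], of "\<lambda>v. v * u"]
  by (simp add: left_diff_distrib mult.assoc diff_eq_eq add.commute)

lemma uea_of_zero [simp]: "uea_of 0 = 0"
  using uea_of_scaleC [of 0 0] by simp

lemma UL_UL: "UL a * (UL b * u) = UL b * (UL a * u) + of_int (b - a) *\<^sub>C (UL (a + b) * u)"
  and UL_UM: "UL a * (UM b * u) = UM b * (UL a * u) + of_int b *\<^sub>C (UM (a + b) * u)"
  and UL_UY: "UL a * (UY b * u) =
    UY b * (UL a * u) + (of_int b + (1 - of_int a) / 2) *\<^sub>C (UY (a + b) * u)"
  and UY_UY: "UY a * (UY b * u) = UY b * (UY a * u) + of_int (b - a) *\<^sub>C (UM (a + b + 1) * u)"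
  and UM_UM: "UM a * (UM b * u) = UM b * (UM a * u)"
  and UM_UY: "UM a * (UY b * u) = UY b * (UM a * u)"
  and UY_UM: "UY a * (UM b * u) = UM b * (UY a * u)"
  and UM_UL: "UM a * (UL b * u) = UL b * (UM a * u) + (- of_int a) *\<^sub>C (UM (a + b) * u)"
  and UY_UL: "UY a * (UL b * u) =
    UL b * (UY a * u) + (- (of_int a + (1 - of_int b) / 2)) *\<^sub>C (UY (a + b) * u)"
  by (subst uea_of_swap, simp only: sv_brackets uea_of_scaleC mult_scaleC_left uea_of_zero
      mult_zero_left add_0_right)+

lemma sv_basis_induct [case_names zero add scale L M Y]:
  assumes "P 0" and "\<And>x y. P x \<Longrightarrow> P y \<Longrightarrow> P (x + y)" and "\<And>c x. P x \<Longrightarrow> P (c *\<^sub>C x)"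
    and "\<And>n. P (sv_L n)" and "\<And>n. P (sv_M n)" and "\<And>n. P (sv_Y n)"
  shows "P x"
proof -
  have "P (Abs_sv p)" for p
  proof (induction p rule: poly_mapping_linear_induct)
    case zero
    then show ?case using assms(1) by (simp add: zero_sv_def)
  next
    case (add p q)
    then show ?case using assms(2) by (simp flip: plus_sv.abs_eq)
  next
    case (single c i)
    have "P (Abs_sv (Poly_Mapping.single i 1))"
      using assms(4-6) by (cases i) (auto simp: sv_L_def sv_M_def sv_Y_def)
    then show ?case using assms(3) by (simp only: scaleC_sv.abs_eq [symmetric])
  qed
  then show ?thesis by (metis sv_coeffs_inverse)
qed

lemma C_L0_closed:
  "1 \<in> C_L0" "c \<in> C_L0 \<Longrightarrow> d \<in> C_L0 \<Longrightarrow> c + d \<in> C_L0"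
  "c \<in> C_L0 \<Longrightarrow> d \<in> C_L0 \<Longrightarrow> c * d \<in> C_L0" "c \<in> C_L0 \<Longrightarrow> a *\<^sub>C c \<in> C_L0" "UL 0 \<in> C_L0"
proof -
  have "subalgebra C_L0"
    unfolding C_L0_def by (rule hull_in) (auto simp: subalgebra_def)
  then show "1 \<in> C_L0" "c \<in> C_L0 \<Longrightarrow> d \<in> C_L0 \<Longrightarrow> c + d \<in> C_L0"
    "c \<in> C_L0 \<Longrightarrow> d \<in> C_L0 \<Longrightarrow> c * d \<in> C_L0" "c \<in> C_L0 \<Longrightarrow> a *\<^sub>C c \<in> C_L0"
    by (auto simp: subalgebra_def)
  show "UL 0 \<in> C_L0" unfolding C_L0_def by (rule hull_inc) simp
qed

text \<open>From \<open>x L\<^sub>0 = (L\<^sub>0 + \<mu>) x\<close> one gets \<open>x f(L\<^sub>0) = f(L\<^sub>0 + \<mu>) x\<close>. A left ideal containing \<open>x\<close> therefore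
  contains \<open>x f(L\<^sub>0)\<close>.\<close>

lemma eigenvector_past_C_L0:
  assumes x: "lie_bracket x (sv_L 0) = \<mu> *\<^sub>C x" and c: "c \<in> C_L0"
  shows "\<exists>d. uea_of x * c = d * uea_of x"
proof -
  let ?x = "uea_of x"
  let ?A = "{c. \<exists>d. ?x * c = d * ?x}"
  have "?x * UL 0 = (UL 0 + \<mu> *\<^sub>C 1) * ?x"
    using uea_of_swap [of x "sv_L 0" 1] by (simp add: x uea_of_scaleC distrib_right)
  moreover have "subalgebra ?A"
    unfolding subalgebra_def
  proof (intro conjI ballI allI)
    show "1 \<in> ?A" by (auto intro: exI [of _ 1])
    fix c assume "c \<in> ?A"
    then obtain d where d: "?x * c = d * ?x" by blast
    then show "a *\<^sub>C c \<in> ?A" for a by (auto intro!: exI [of _ "a *\<^sub>C d"])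
    fix c' assume "c' \<in> ?A"
    then obtain d' where d': "?x * c' = d' * ?x" by blast
    show "c + c' \<in> ?A" using d d' by (auto intro!: exI [of _ "d + d'"] simp: distrib_left distrib_right)
    have "?x * (c * c') = d * d' * ?x"
      using d d' by (metis mult.assoc)
    then show "c * c' \<in> ?A" by blast
  qed
  ultimately have "C_L0 \<subseteq> ?A"
    unfolding C_L0_def by (intro hull_minimal) auto
  then show ?thesis using c by blast
qed

section \<open>Left ideals annihilating a highest weight vector\<close>

locale highest_weight_ideal =
  fixes I :: "sv uea set" and \<xi> :: complex
  assumes zero: "0 \<in> I" and plus: "u \<in> I \<Longrightarrow> v \<in> I \<Longrightarrow> u + v \<in> I" and left: "v \<in> I \<Longrightarrow> u * v \<in> I"
    and ULI: "1 \<le> n \<Longrightarrow> UL n \<in> I" and UMI: "1 \<le> n \<Longrightarrow> UM n \<in> I" and UYI: "0 \<le> n \<Longrightarrow> UY n \<in> I"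
    and M0: "UM 0 - \<xi> *\<^sub>C 1 \<in> I" and \<xi>: "\<xi> \<noteq> 0"
begin

lemma subspace_I: "complex_vector.subspace I"
proof -
  have "c *\<^sub>C u \<in> I" if "u \<in> I" for c u
    using left [OF that, of "c *\<^sub>C 1"] by simp
  then show ?thesis using zero plus by (simp add: complex_vector.subspace_def)
qed

text \<open>
  Words are built up from the right, one kind of letter at a time. Every layer contains \<open>I\<close>, so that
  equality modulo \<open>I\<close> never has to be mentioned in the spanning argument. The letter \<open>UY (- a)\<close> is
  \<open>Y\<^bsub>-a+1/2\<^esub>\<close>, so \<open>a \<ge> 1\<close> gives exactly the negative modes.
\<close>

definition S0 where "S0 = {c + i | c i. c \<in> C_L0 \<and> i \<in> I}"
definition S1 where "S1 = words (\<lambda>a. UM (- a)) S0"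
definition S2 where "S2 = words (\<lambda>a. UY (- a)) S1"
definition S3 where "S3 = words (\<lambda>a. UL (- a)) S2"

lemma I_S0: "I \<subseteq> S0"
proof
  fix i assume "i \<in> I"
  moreover have "0 \<in> C_L0" using C_L0_closed(4) [OF C_L0_closed(1), of 0] by simp
  ultimately show "i \<in> S0" unfolding S0_def by force
qed

lemma subspace_S0: "complex_vector.subspace S0"
  unfolding complex_vector.subspace_def
proof (intro conjI ballI allI)
  show "0 \<in> S0" using zero I_S0 by blast
  fix u assume "u \<in> S0"
  then obtain c i where u: "u = c + i" "c \<in> C_L0" "i \<in> I" by (auto simp: S0_def)
  have "a *\<^sub>C u = a *\<^sub>C c + a *\<^sub>C i" for a by (simp add: u scaleC_add_right)
  then show "a *\<^sub>C u \<in> S0" for a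
    using u C_L0_closed(4) complex_vector.subspace_scale [OF subspace_I] unfolding S0_def by blast
  fix v assume "v \<in> S0"
  then obtain d j where v: "v = d + j" "d \<in> C_L0" "j \<in> I" by (auto simp: S0_def)
  have "u + v = (c + d) + (i + j)" by (simp add: u v add_ac)
  then show "u + v \<in> S0"
    using u v C_L0_closed(2) plus unfolding S0_def by blast
qed

lemma subspace_S1: "complex_vector.subspace S1" and subspace_S2: "complex_vector.subspace S2"
  and subspace_S3: "complex_vector.subspace S3"
  unfolding S1_def S2_def S3_def by (intro subspace_words subspace_S0)+

lemma S0_S1: "S0 \<subseteq> S1" and I_S1: "I \<subseteq> S1" and S1_S2: "S1 \<subseteq> S2" and S2_S3: "S2 \<subseteq> S3"
  using I_S0 by (auto simp: S1_def S2_def S3_def intro: words_base)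

lemma UY_letter_S2: "u \<in> S2 \<Longrightarrow> 1 \<le> a \<Longrightarrow> UY (- a) * u \<in> S2"
  and UL_letter_S3: "u \<in> S3 \<Longrightarrow> 1 \<le> a \<Longrightarrow> UL (- a) * u \<in> S3"
  unfolding S2_def S3_def by (rule words_letter; assumption)+

lemma I_S2: "I \<subseteq> S2"
  using I_S1 S1_S2 by blast

lemma eigenvector_S0:
  assumes "lie_bracket x (sv_L 0) = \<mu> *\<^sub>C x" and "uea_of x \<in> I" and "s \<in> S0"
  shows "uea_of x * s \<in> I"
proof -
  obtain c i where s: "s = c + i" "c \<in> C_L0" "i \<in> I" using assms(3) by (auto simp: S0_def)
  obtain d where "uea_of x * c = d * uea_of x"
    using eigenvector_past_C_L0 [OF assms(1) s(2)] by blast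
  then show ?thesis using left assms(2) s plus by (simp add: distrib_left)
qed

lemma UL_S0_I: "1 \<le> k \<Longrightarrow> s \<in> S0 \<Longrightarrow> UL k * s \<in> I"
  using eigenvector_S0 [of "sv_L k" "- of_int k" s] ULI by (simp add: sv_brackets)

lemma UM_S0_I: "1 \<le> k \<Longrightarrow> s \<in> S0 \<Longrightarrow> UM k * s \<in> I"
  using eigenvector_S0 [of "sv_M k" "- of_int k" s] UMI by (simp add: sv_brackets)

lemma UY_S0_I: "0 \<le> k \<Longrightarrow> s \<in> S0 \<Longrightarrow> UY k * s \<in> I"
  using eigenvector_S0 [of "sv_Y k" "- (of_int k + 1 / 2)" s] UYI by (simp add: sv_brackets)

lemma UL_S0: "0 \<le> k \<Longrightarrow> s \<in> S0 \<Longrightarrow> UL k * s \<in> S0"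
proof (cases "k = 0")
  case True
  assume "s \<in> S0"
  then obtain c i where s: "s = c + i" "c \<in> C_L0" "i \<in> I" by (auto simp: S0_def)
  then show ?thesis
    using C_L0_closed(3) [OF C_L0_closed(5) s(2)] left [OF s(3)] True
    by (auto simp: S0_def distrib_left)
next
  case False
  then show "0 \<le> k \<Longrightarrow> s \<in> S0 \<Longrightarrow> UL k * s \<in> S0" using UL_S0_I I_S0 by auto
qed

lemma UM_zero: "UM 0 * u - \<xi> *\<^sub>C u \<in> I"
  using left [OF M0, of u] uea_of_central [OF sv_M0_central, of u]
  by (simp add: right_diff_distrib)

lemma UM_zero_closed:
  assumes "I \<subseteq> S" "complex_vector.subspace S" "u \<in> S"
  shows "UM 0 * u \<in> S"
proof -
  have "(UM 0 * u - \<xi> *\<^sub>C u) + \<xi> *\<^sub>C u \<in> S"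
    using assms UM_zero by (intro complex_vector.subspace_add complex_vector.subspace_scale) auto
  then show ?thesis by simp
qed

text \<open>
  The action of the generators on a layer is determined from that on the inner layers. The order of
  the lemmas is such that all commutators are already known to preserve the layer: passing a letter,
  \<open>L\<^sub>k\<close> leaves a generator of the kind of that letter, \<open>Y\<^sub>k\<close> passing a \<open>Y\<close> leaves an \<open>M\<close>, and \<open>M\<^sub>k\<close>
  commutes with \<open>M\<close> and \<open>Y\<close> and leaves an \<open>M\<close> when it passes an \<open>L\<close>.
\<close>

lemma UM_S1_I:
  assumes "1 \<le> k" and "u \<in> S1"
  shows "UM k * u \<in> I"
proof (rule mult_words [where z = UM and K = "{1..}", OF S1_def subspace_I])
  show "UM k * s \<in> I" if "s \<in> S0" "k \<in> {1..}" for s k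
    using that UM_S0_I by auto
  show "UM k * (UM (- a) * u) \<in> I"
    if "u \<in> S1" "\<And>k. k \<in> {1..} \<Longrightarrow> UM k * u \<in> I" "1 \<le> a" "k \<in> {1..}" for u a k
    unfolding UM_UM [of k "- a"] using that left by auto
qed (use assms in auto)

lemma UM_S1:
  assumes u: "u \<in> S1"
  shows "UM k * u \<in> S1"
proof -
  consider "k \<ge> 1" | "k = 0" | "k \<le> - 1" by linarith
  then show ?thesis
  proof cases
    case 1 then show ?thesis using UM_S1_I [OF _ u] I_S1 by blast
  next
    case 2 then show ?thesis using UM_zero_closed [OF I_S1 subspace_S1 u] by simp
  next
    case 3 then show ?thesis
      using words_letter [of u "\<lambda>a. UM (- a)" S0 "- k"] u by (simp add: S1_def)
  qed
qed

lemma UY_S1_I: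
  assumes "0 \<le> k" and "u \<in> S1"
  shows "UY k * u \<in> I"
proof (rule mult_words [where z = UY and K = "{0..}", OF S1_def subspace_I])
  show "UY k * s \<in> I" if "s \<in> S0" "k \<in> {0..}" for s k
    using that UY_S0_I by auto
  show "UY k * (UM (- a) * u) \<in> I"
    if "u \<in> S1" "\<And>k. k \<in> {0..} \<Longrightarrow> UY k * u \<in> I" "1 \<le> a" "k \<in> {0..}" for u a k
    unfolding UY_UM [of k "- a"] using that left by auto
qed (use assms in auto)

lemma UL_S1:
  assumes "0 \<le> k" and "u \<in> S1"
  shows "UL k * u \<in> S1"
proof (rule mult_words [where z = UL and K = "{0..}", OF S1_def subspace_S1])
  show "UL k * s \<in> S1" if "s \<in> S0" "k \<in> {0..}" for s k
    using that UL_S0 S0_S1 by auto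
  show "UL k * (UM (- a) * u) \<in> S1"
    if "u \<in> S1" "\<And>k. k \<in> {0..} \<Longrightarrow> UL k * u \<in> S1" "1 \<le> a" "k \<in> {0..}" for u a k
    unfolding UL_UM [of k "- a"] using that UM_S1
    by (intro complex_vector.subspace_add [OF subspace_S1] complex_vector.subspace_scale [OF subspace_S1]) auto
qed (use assms in auto)

lemma UM_S2_I:
  assumes "1 \<le> k" and "u \<in> S2"
  shows "UM k * u \<in> I"
proof (rule mult_words [where z = UM and K = "{1..}", OF S2_def subspace_I])
  show "UM k * s \<in> I" if "s \<in> S1" "k \<in> {1..}" for s k
    using that UM_S1_I by auto
  show "UM k * (UY (- a) * u) \<in> I"
    if "u \<in> S2" "\<And>k. k \<in> {1..} \<Longrightarrow> UM k * u \<in> I" "1 \<le> a" "k \<in> {1..}" for u a k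
    unfolding UM_UY [of k "- a"] using that left by auto
qed (use assms in auto)

lemma UM_S2:
  assumes "u \<in> S2"
  shows "UM k * u \<in> S2"
proof (rule mult_words [where z = UM and K = UNIV, OF S2_def subspace_S2])
  show "UM k * s \<in> S2" if "s \<in> S1" "k \<in> UNIV" for s k
    using that UM_S1 S1_S2 by auto
  show "UM k * (UY (- a) * u) \<in> S2"
    if "u \<in> S2" "\<And>k. k \<in> UNIV \<Longrightarrow> UM k * u \<in> S2" "1 \<le> a" "k \<in> UNIV" for u a k
    unfolding UM_UY [of k "- a"] using that UY_letter_S2 by auto
qed (use assms in auto)

lemma UY_S2:
  assumes u: "u \<in> S2"
  shows "UY k * u \<in> S2"
proof (cases "0 \<le> k")
  case True
  show ?thesis
  proof (rule mult_words [where z = UY and K = "{0..}", OF S2_def subspace_S2])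
    show "UY k * s \<in> S2" if "s \<in> S1" "k \<in> {0..}" for s k
      using that UY_S1_I I_S2 by auto
    show "UY k * (UY (- a) * u) \<in> S2"
      if "u \<in> S2" "\<And>k. k \<in> {0..} \<Longrightarrow> UY k * u \<in> S2" "1 \<le> a" "k \<in> {0..}" for u a k
      unfolding UY_UY [of k "- a"] using that UM_S2 UY_letter_S2
      by (intro complex_vector.subspace_add [OF subspace_S2] complex_vector.subspace_scale [OF subspace_S2]) auto
  qed (use u True in auto)
next
  case False
  then show ?thesis
    using UY_letter_S2 [OF u, of "- k"] by simp
qed

lemma UL_S2:
  assumes "0 \<le> k" and "u \<in> S2"
  shows "UL k * u \<in> S2"
proof (rule mult_words [where z = UL and K = "{0..}", OF S2_def subspace_S2])
  show "UL k * s \<in> S2" if "s \<in> S1" "k \<in> {0..}" for s k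
    using that UL_S1 S1_S2 by auto
  show "UL k * (UY (- a) * u) \<in> S2"
    if "u \<in> S2" "\<And>k. k \<in> {0..} \<Longrightarrow> UL k * u \<in> S2" "1 \<le> a" "k \<in> {0..}" for u a k
    unfolding UL_UY [of k "- a"] using that UY_S2
    by (intro complex_vector.subspace_add [OF subspace_S2] complex_vector.subspace_scale [OF subspace_S2]) auto
qed (use assms in auto)

lemma UM_S3:
  assumes "u \<in> S3"
  shows "UM k * u \<in> S3"
proof (rule mult_words [where z = UM and K = UNIV, OF S3_def subspace_S3])
  show "UM k * s \<in> S3" if "s \<in> S2" "k \<in> UNIV" for s k
    using that UM_S2 S2_S3 by auto
  show "UM k * (UL (- a) * u) \<in> S3"
    if "u \<in> S3" "\<And>k. k \<in> UNIV \<Longrightarrow> UM k * u \<in> S3" "1 \<le> a" "k \<in> UNIV" for u a k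
    unfolding UM_UL [of k "- a"] using that UL_letter_S3
    by (intro complex_vector.subspace_add [OF subspace_S3] complex_vector.subspace_scale [OF subspace_S3]) auto
qed (use assms in auto)

lemma UY_S3:
  assumes "u \<in> S3"
  shows "UY k * u \<in> S3"
proof (rule mult_words [where z = UY and K = UNIV, OF S3_def subspace_S3])
  show "UY k * s \<in> S3" if "s \<in> S2" "k \<in> UNIV" for s k
    using that UY_S2 S2_S3 by auto
  show "UY k * (UL (- a) * u) \<in> S3"
    if "u \<in> S3" "\<And>k. k \<in> UNIV \<Longrightarrow> UY k * u \<in> S3" "1 \<le> a" "k \<in> UNIV" for u a k
    unfolding UY_UL [of k "- a"] using that UL_letter_S3
    by (intro complex_vector.subspace_add [OF subspace_S3] complex_vector.subspace_scale [OF subspace_S3]) auto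
qed (use assms in auto)

lemma UL_S3:
  assumes "u \<in> S3"
  shows "UL k * u \<in> S3"
proof (rule mult_words [where z = UL and K = UNIV, OF S3_def subspace_S3])
  show "UL k * s \<in> S3" if "s \<in> S2" for s k
  proof (cases "0 \<le> k")
    case True
    then show ?thesis using UL_S2 that S2_S3 by auto
  next
    case False
    then show ?thesis using UL_letter_S3 [of s "- k"] that S2_S3 by auto
  qed
  show "UL k * (UL (- a) * u) \<in> S3"
    if "u \<in> S3" "\<And>k. k \<in> UNIV \<Longrightarrow> UL k * u \<in> S3" "1 \<le> a" for u a k
    unfolding UL_UL [of k "- a"] using that UL_letter_S3
    by (intro complex_vector.subspace_add [OF subspace_S3] complex_vector.subspace_scale [OF subspace_S3]) auto
qed (use assms in auto)

text \<open>The last layer contains \<open>1\<close> and is stable under all generators.\<close>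

lemma S3_UNIV: "u \<in> S3"
proof -
  have gen: "uea_of x * v \<in> S3" if "v \<in> S3" for x v
  proof (induction x rule: sv_basis_induct)
    case zero
    show ?case using complex_vector.subspace_0 [OF subspace_S3] by simp
  next
    case (add x y)
    then show ?case by (simp add: uea_of_add distrib_right complex_vector.subspace_add [OF subspace_S3])
  next
    case (scale c x)
    then show ?case by (simp add: uea_of_scaleC complex_vector.subspace_scale [OF subspace_S3])
  qed (simp_all add: that UL_S3 UM_S3 UY_S3)
  have "\<forall>v\<in>S3. u * v \<in> S3"
  proof (induction u rule: uea_induct)
    case (add u v)
    then show ?case by (simp add: distrib_right complex_vector.subspace_add [OF subspace_S3])
  next
    case (scaleC c u)
    then show ?case by (simp add: complex_vector.subspace_scale [OF subspace_S3])
  qed (simp_all add: gen mult.assoc)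
  moreover have "1 \<in> S3"
  proof -
    have "1 \<in> S0" unfolding S0_def using C_L0_closed(1) zero by force
    then have "1 \<in> S1" by (auto simp: S1_def intro: words_base)
    then show ?thesis using S1_S2 S2_S3 by blast
  qed
  ultimately have "u * 1 \<in> S3" by blast
  then show ?thesis by simp
qed

text \<open>
  Here \<open>[M\<^sub>n, L\<^bsub>-a\<^esub>] = -n M\<^bsub>n-a\<^esub>\<close>. Any \<open>M\<^sub>k\<close> preserves the length in letters \<open>L\<close>, and one with
  \<open>k > 0\<close> lowers it, because it can only survive by being turned into some \<open>M\<^sub>j\<close>, \<open>j \<le> 0\<close>, at the
  expense of letters. For \<open>a < n\<close> the commutator is again an \<open>M\<^sub>k\<close> with \<open>k > 0\<close>: the letter and at
  least one further one are lost.
\<close>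

lemma in_S2_if_killed_by_M:
  assumes "\<And>n. 1 \<le> n \<Longrightarrow> UM n * v \<in> I"
  shows "v \<in> S2"
proof (rule words_descent [where I = I and x = "\<lambda>a. UL (- a)" and z = UM and \<kappa> = "\<lambda>n. - of_int n * \<xi>"])
  let ?D = "words_upto (\<lambda>a. UL (- a)) I S2"
  note sub = subspace_words_upto [OF subspace_I subspace_S2, of "\<lambda>a. UL (- a)"]
  have UM_D: "UM k * u \<in> ?D s" if "u \<in> ?D s" for k s u
  proof -
    have "UM k * u \<in> ?D (s + 0)"
    proof (rule mult_words_upto [where z = UM and K = UNIV, OF subspace_I I_S2 left subspace_S2 _ _ _ that])
      fix s and k :: int assume "s \<in> S2"
      then show "UM k * s \<in> ?D 0"
        using UM_S2 by (simp add: words_upto_def word_span.base)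
    next
      fix r u and a k :: int assume *: "\<And>k. k \<in> UNIV \<Longrightarrow> UM k * u \<in> ?D (int r + 0)"
      have "UM j * u \<in> ?D (int r + 1)" for j
        using words_upto_mono [OF * I_S2, of j "int r + 1"] by simp
      then show "UM k * (UL (- a) * u) - UL (- a) * (UM k * u) \<in> ?D (int r + 1 + 0)"
        unfolding UM_UL by (simp add: complex_vector.subspace_neg [OF sub] complex_vector.subspace_scale [OF sub])
    qed simp_all
    then show ?thesis by simp
  qed
  have UM_lowers: "UM n * u \<in> ?D (s - 1)" if "1 \<le> n" "u \<in> ?D s" for n s u
  proof -
    have "UM n * u \<in> ?D (s + - 1)"
    proof (rule mult_words_upto [where z = UM and K = "{1..}", OF subspace_I I_S2 left subspace_S2 _ _ _ that(2)])
      fix s and k :: int assume "k \<in> {1..}" "s \<in> S2"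
      then show "UM k * s \<in> ?D (- 1)"
        using UM_S2_I by (simp add: words_upto_def)
    next
      fix r u and a k :: int assume u: "word_span (\<lambda>a. UL (- a)) {1..} S2 r u"
      have "UM j * u \<in> ?D (int r)" for j
        using UM_D [of u "int r" j] u by (simp add: words_upto_of_nat)
      then show "UM k * (UL (- a) * u) - UL (- a) * (UM k * u) \<in> ?D (int r + 1 + - 1)"
        unfolding UM_UL by (simp add: complex_vector.subspace_neg [OF sub] complex_vector.subspace_scale [OF sub])
    qed (use that in simp_all)
    then show ?thesis by simp
  qed
  show "UM n * u \<in> ?D (s - 1)" if "1 \<le> n" "u \<in> ?D s" for n s u
    using that by (rule UM_lowers)
  show "UL (- a) * (UL (- b) * u) - UL (- b) * (UL (- a) * u) \<in> ?D (int r + 1)"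
    if "1 \<le> a" "1 \<le> b" "word_span (\<lambda>a. UL (- a)) {1..} S2 r u" for a b r u
  proof -
    have "UL (- (a + b)) * u \<in> ?D (int r + 1)"
      using words_upto_letter [OF I_S2 left, of "a + b" u "\<lambda>a. UL (- a)" "int r"] that
      by (simp add: words_upto_of_nat)
    then show ?thesis
      unfolding UL_UL [of "- a" "- b"] by (simp add: complex_vector.subspace_scale [OF sub])
  qed
  show "UM n * (UL (- n) * u) - UL (- n) * (UM n * u) - (- of_int n * \<xi>) *\<^sub>C u \<in> I" for n u
  proof -
    have "(- of_int n) *\<^sub>C (UM 0 * u - \<xi> *\<^sub>C u) \<in> I"
      by (rule complex_vector.subspace_scale [OF subspace_I UM_zero])
    then show ?thesis
      unfolding UM_UL by (simp add: complex_vector.scale_right_diff_distrib)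
  qed
  show "UM n * u \<in> ?D (int r - 2)"
    if "1 \<le> n" "word_span (\<lambda>a. UL (- a)) {1..n - 1} S2 r u" for n r u
    using that(2)
  proof (rule mult_word_span [where K = "{n}" and z = UM, rotated 3])
    fix r u and a k :: int
    assume *: "word_span (\<lambda>a. UL (- a)) {1..n - 1} S2 r u"
      "\<And>k. k \<in> {n} \<Longrightarrow> UM k * u \<in> ?D (int r - 2)" "a \<in> {1..n - 1}" "k \<in> {n}"
    have "word_span (\<lambda>a. UL (- a)) {1..} S2 r u"
      using *(1) by (rule word_span_mono_letters) auto
    then have "UM (n - a) * u \<in> ?D (int r - 1)"
      using UM_lowers [of "n - a" u "int r"] *(3) by (simp add: words_upto_of_nat)
    moreover have "UL (- a) * (UM n * u) \<in> ?D (int r - 1)"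
      using words_upto_letter [OF I_S2 left, of a "UM n * u" "\<lambda>a. UL (- a)" "int r - 2"] *(2,3)
      by simp
    ultimately show "UM k * (UL (- a) * u) \<in> ?D (int (Suc r) - 2)"
      using *(4) unfolding UM_UL
      by (simp add: complex_vector.subspace_diff [OF sub] complex_vector.subspace_scale [OF sub])
  next
    show "UM k * s \<in> ?D (int r - 2)" if "s \<in> S2" "k \<in> {n}" for r s k
      using that \<open>1 \<le> n\<close> by (auto intro!: ideal_subset_words_upto [OF I_S2] UM_S2_I)
  qed (auto intro: sub)
  show "v \<in> words (\<lambda>a. UL (- a)) S2"
    using S3_UNIV by (simp add: S3_def)
qed (use subspace_I I_S2 left subspace_S2 \<xi> assms in auto)

text \<open>
  The mode opposite to \<open>UY (- n)\<close> is \<open>UY (n - 1)\<close>, and their commutator is \<open>(1 - 2 n) M\<^sub>0\<close>, which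
  is nonzero as \<open>1 - 2 n\<close> is odd. For \<open>a < n\<close> the commutator with \<open>UY (- a)\<close> is a multiple of
  \<open>M\<^bsub>n-a\<^esub>\<close>, which sends the whole layer into \<open>I\<close>.
\<close>

lemma in_S1_if_killed_by_Y:
  assumes v: "v \<in> S2" and "\<And>n. 0 \<le> n \<Longrightarrow> UY n * v \<in> I"
  shows "v \<in> S1"
proof (rule words_descent [where I = I and x = "\<lambda>a. UY (- a)" and z = "\<lambda>n. UY (n - 1)"
      and \<kappa> = "\<lambda>n. of_int (1 - 2 * n) * \<xi>"])
  let ?D = "words_upto (\<lambda>a. UY (- a)) I S1"
  note sub = subspace_words_upto [OF subspace_I subspace_S1, of "\<lambda>a. UY (- a)"]
  have UM_D: "UM k * u \<in> ?D s" if "u \<in> ?D s" for k s u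
  proof -
    have "UM k * u \<in> ?D (s + 0)"
    proof (rule mult_words_upto [where z = UM and K = UNIV, OF subspace_I I_S1 left subspace_S1 _ _ _ that])
      fix s and k :: int assume "s \<in> S1"
      then show "UM k * s \<in> ?D 0"
        using UM_S1 by (simp add: words_upto_def word_span.base)
    qed (simp_all add: UM_UY complex_vector.subspace_0 [OF sub])
    then show ?thesis by simp
  qed
  show "UY (n - 1) * u \<in> ?D (s - 1)" if "1 \<le> n" "u \<in> ?D s" for n s u
  proof -
    have "UY (n - 1) * u \<in> ?D (s + - 1)"
    proof (rule mult_words_upto [where z = UY and K = "{0..}", OF subspace_I I_S1 left subspace_S1 _ _ _ that(2)])
      fix s and k :: int assume "k \<in> {0..}" "s \<in> S1"
      then show "UY k * s \<in> ?D (- 1)"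
        using UY_S1_I by (simp add: words_upto_def)
    next
      fix r u and a k :: int assume u: "word_span (\<lambda>a. UY (- a)) {1..} S1 r u"
      have "UM j * u \<in> ?D (int r)" for j
        using UM_D [of u "int r" j] u by (simp add: words_upto_of_nat)
      then show "UY k * (UY (- a) * u) - UY (- a) * (UY k * u) \<in> ?D (int r + 1 + - 1)"
        unfolding UY_UY [of k] by (simp add: complex_vector.subspace_scale [OF sub])
    qed (use that in simp_all)
    then show ?thesis by simp
  qed
  show "UY (- a) * (UY (- b) * u) - UY (- b) * (UY (- a) * u) \<in> ?D (int r + 1)"
    if "1 \<le> a" "1 \<le> b" "word_span (\<lambda>a. UY (- a)) {1..} S1 r u" for a b r u
  proof -
    have "UM j * u \<in> ?D (int r + 1)" for j
      using words_upto_mono [OF UM_D I_S1, of u "int r" "int r + 1"] that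
      by (simp add: words_upto_of_nat)
    then show ?thesis
      unfolding UY_UY [of "- a"] by (simp add: complex_vector.subspace_scale [OF sub])
  qed
  show "UY (n - 1) * (UY (- n) * u) - UY (- n) * (UY (n - 1) * u)
      - (of_int (1 - 2 * n) * \<xi>) *\<^sub>C u \<in> I" for n u
  proof -
    have "of_int (1 - 2 * n) *\<^sub>C (UM 0 * u - \<xi> *\<^sub>C u) \<in> I"
      by (rule complex_vector.subspace_scale [OF subspace_I UM_zero])
    moreover have "- n - (n - 1) = 1 - 2 * n" by simp
    ultimately show ?thesis
      unfolding UY_UY [of "n - 1"] by (simp add: complex_vector.scale_right_diff_distrib)
  qed
  show "UY (n - 1) * u \<in> ?D (int r - 2)"
    if "1 \<le> n" "word_span (\<lambda>a. UY (- a)) {1..n - 1} S1 r u" for n r u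
  proof -
    have "UY (n - 1) * u \<in> I"
      using that(2)
    proof (rule mult_word_span [where K = "{n - 1}" and z = UY and T = "\<lambda>_. I", rotated 3])
      fix r u and a k :: int
      assume *: "word_span (\<lambda>a. UY (- a)) {1..n - 1} S1 r u"
        "\<And>k. k \<in> {n - 1} \<Longrightarrow> UY k * u \<in> I" "a \<in> {1..n - 1}" "k \<in> {n - 1}"
      have "u \<in> S2"
        unfolding S2_def using *(1) by (rule word_span_words) auto
      then have "UM (n - a) * u \<in> I"
        using UM_S2_I *(3) by simp
      then show "UY k * (UY (- a) * u) \<in> I"
        using *(2,4) left unfolding UY_UY [of k]
        by (simp add: complex_vector.subspace_add [OF subspace_I] complex_vector.subspace_scale [OF subspace_I])
    qed (use that subspace_I UY_S1_I in auto)
    then show ?thesis by (rule ideal_subset_words_upto [OF I_S1])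
  qed
  show "v \<in> words (\<lambda>a. UY (- a)) S1"
    using v by (simp add: S2_def)
  show "of_int (1 - 2 * n) * \<xi> \<noteq> 0" for n
  proof -
    have "1 - 2 * n \<noteq> 0" by presburger
    then have "(of_int (1 - 2 * n) :: complex) \<noteq> 0" by (simp only: of_int_eq_0_iff simp_thms)
    then show ?thesis using \<xi> by simp
  qed
qed (use subspace_I I_S1 left subspace_S1 assms in auto)

text \<open>
  The letters \<open>M\<^bsub>-a\<^esub>\<close> commute, but \<open>L\<^sub>n\<close> preserves the length of words in them: it replaces
  \<open>M\<^bsub>-a\<^esub>\<close> by \<open>M\<^bsub>n-a\<^esub>\<close>. So in place of the filtration by length the constant one is taken.
\<close>

lemma in_S0_if_killed_by_L:
  assumes v: "v \<in> S1" and Lv: "\<And>n. 1 \<le> n \<Longrightarrow> UL n * v \<in> I"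
  shows "v \<in> S0"
proof -
  obtain r where r: "word_span (\<lambda>a. UM (- a)) {1..} S0 r v"
    using v by (auto simp: S1_def words_def)
  have "\<exists>s\<in>S0. v - s \<in> I"
  proof (rule elimination [where D = "\<lambda>_. I" and z = UL and \<kappa> = "\<lambda>n. - of_int n * \<xi>",
        OF subspace_S0 _ _ _ _ _ _ _ r])
    show "UL n * (UM (- n) * u) - UM (- n) * (UL n * u) - (- of_int n * \<xi>) *\<^sub>C u \<in> I" for n u
    proof -
      have "(- of_int n) *\<^sub>C (UM 0 * u - \<xi> *\<^sub>C u) \<in> I"
        by (rule complex_vector.subspace_scale [OF subspace_I UM_zero])
      then show ?thesis
        unfolding UL_UM by (simp add: complex_vector.scale_right_diff_distrib)
    qed
    show "UL n * u \<in> I"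
      if "1 \<le> n" "word_span (\<lambda>a. UM (- a)) {1..n - 1} S0 r u" for n r u
      using that(2)
    proof (rule mult_word_span [where K = "{n}" and z = UL and T = "\<lambda>_. I", rotated 3])
      fix r u and a k :: int
      assume *: "word_span (\<lambda>a. UM (- a)) {1..n - 1} S0 r u"
        "\<And>k. k \<in> {n} \<Longrightarrow> UL k * u \<in> I" "a \<in> {1..n - 1}" "k \<in> {n}"
      have "u \<in> S1"
        unfolding S1_def using *(1) by (rule word_span_words) auto
      then have "UM (n - a) * u \<in> I"
        using UM_S1_I *(3) by simp
      then show "UL k * (UM (- a) * u) \<in> I"
        using *(2,4) left unfolding UL_UM
        by (simp add: complex_vector.subspace_diff [OF subspace_I] complex_vector.subspace_scale [OF subspace_I])
    qed (use that subspace_I UL_S0_I in auto)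
    show "UM (- a) * (UM (- b) * u) - UM (- b) * (UM (- a) * u) \<in> I" for a b u
      using zero by (simp add: UM_UM [of "- a"])
  qed (use subspace_I left \<xi> Lv in auto)
  then obtain s where s: "s \<in> S0" "v - s \<in> I" by blast
  then have "(v - s) + s \<in> S0"
    using I_S0 by (intro complex_vector.subspace_add [OF subspace_S0]) auto
  then show ?thesis by simp
qed

lemma singular_in_C_L0:
  assumes "\<And>n. 1 \<le> n \<Longrightarrow> UL n * v \<in> I" and "\<And>n. 1 \<le> n \<Longrightarrow> UM n * v \<in> I"
    and "\<And>n. 0 \<le> n \<Longrightarrow> UY n * v \<in> I"
  shows "\<exists>c\<in>C_L0. v - c \<in> I"
proof -
  have "v \<in> S0"
    by (intro in_S0_if_killed_by_L in_S1_if_killed_by_Y in_S2_if_killed_by_M assms)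
  then obtain c i where "v = c + i" "c \<in> C_L0" "i \<in> I" by (auto simp: S0_def)
  then show ?thesis by (intro bexI [of _ c]) auto
qed

text \<open>The easy inclusion; linearity extends it from the basis to all of \<open>sv\<^sup>+\<close>.\<close>

lemma C_L0_singular:
  assumes "c \<in> C_L0"
  shows "uea_of (sv_plus_incl x) * c \<in> I"
proof -
  have c: "c \<in> S0" unfolding S0_def using assms zero by force
  have "uea_of y * c \<in> I" if "y \<in> complex_vector.span sv_plus_basis" for y
    using that
  proof (induction y rule: complex_vector.span_induct_alt)
    case base
    show ?case using zero by simp
  next
    case (step a b y)
    have "uea_of b * c \<in> I"
      using step(1) UL_S0_I UM_S0_I UY_S0_I c by (auto simp: sv_plus_basis_def)
    then show ?case
      using step by (simp add: uea_of_add uea_of_scaleC distrib_right plus complex_vector.subspace_scale [OF subspace_I])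
  qed
  then show ?thesis using sv_plus_incl by blast
qed

end

section \<open>The Whittaker module as a quotient of the enveloping algebra\<close>

definition W_class :: "(sv_plus \<Rightarrow> complex) \<Rightarrow> sv uea \<Rightarrow> (sv uea \<times> complex \<Rightarrow>\<^sub>0 int) set" where
  "W_class \<psi> u = frag_of (u, 1) +o W_null \<psi>"

lemma W_null_relators:
  "frag_of (u + v, \<alpha>) - frag_of (u, \<alpha>) - frag_of (v, \<alpha>) \<in> W_null \<psi>"
  "frag_of (u, \<alpha> + \<beta>) - frag_of (u, \<alpha>) - frag_of (u, \<beta>) \<in> W_null \<psi>"
  "frag_of (u * uea_map sv_plus_incl r, \<alpha>) - frag_of (u, uea_lift \<psi> r * \<alpha>) \<in> W_null \<psi>"
  unfolding W_null_def tensor_null_def by (rule hull_inc, blast)+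

lemma W_null_group:
  "x \<in> W_null \<psi> \<Longrightarrow> y \<in> W_null \<psi> \<Longrightarrow> x + y \<in> W_null \<psi>"
  "x \<in> W_null \<psi> \<Longrightarrow> - x \<in> W_null \<psi>"
  "x \<in> W_null \<psi> \<Longrightarrow> y \<in> W_null \<psi> \<Longrightarrow> x - y \<in> W_null \<psi>"
proof -
  note g = add_subgroupD [OF add_subgroup_W_null [of \<psi>]]
  show "x \<in> W_null \<psi> \<Longrightarrow> y \<in> W_null \<psi> \<Longrightarrow> x + y \<in> W_null \<psi>" "x \<in> W_null \<psi> \<Longrightarrow> - x \<in> W_null \<psi>"
    using g by blast+
  show "x \<in> W_null \<psi> \<Longrightarrow> y \<in> W_null \<psi> \<Longrightarrow> x - y \<in> W_null \<psi>"
    using g(2) [of x "- y"] g(3) [of y] by simp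
qed

lemma W_class_in_carrier [simp]: "W_class \<psi> u \<in> W_carrier \<psi>"
  by (simp add: W_class_def)

lemma W_class_add: "W_class \<psi> u + W_class \<psi> v = W_class \<psi> (u + v)"
proof -
  have "(frag_of (u, 1) + frag_of (v, 1)) - frag_of (u + v, 1) \<in> W_null \<psi>"
    using W_null_group(2) [OF W_null_relators(1) [of u v 1 \<psi>]] by (simp add: algebra_simps)
  then show ?thesis
    by (simp add: W_class_def add_subgroup_coset_plus add_subgroup_W_null W_coset_eqI)
qed

lemma W_class_zero: "W_class \<psi> 0 = W_null \<psi>"
proof -
  have "frag_of (0, 1) - 0 \<in> W_null \<psi>"
    using W_null_group(2) [OF W_null_relators(1) [of 0 0 1 \<psi>]] by simp
  from W_coset_eqI [OF this] show ?thesis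
    by (simp add: W_class_def elt_set_plus_def)
qed

lemma W_act_class: "W_act \<psi> u (W_class \<psi> v) = W_class \<psi> (u * v)"
  by (simp add: W_class_def W_act_coset)

text \<open>
  A pure tensor \<open>u \<otimes> \<alpha>\<close> equals \<open>\<alpha> u \<otimes> 1\<close>, because \<open>\<alpha> 1 \<in> U(sv\<^sup>+)\<close> can be moved across the tensor
  sign.
\<close>

lemma W_class_surj:
  assumes "lie_hom \<psi>" and "w \<in> W_carrier \<psi>"
  shows "\<exists>u. w = W_class \<psi> u"
proof -
  have pair: "frag_of (u, \<alpha>) - frag_of (\<alpha> *\<^sub>C u, 1) \<in> W_null \<psi>" for u \<alpha>
  proof -
    have "lie_hom_commutator \<psi>" using assms(1) by (simp add: lie_hom_complex_iff)
    then have "uea_lift \<psi> (\<alpha> *\<^sub>C 1) = \<alpha>"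
      by (simp add: uea_lift_scaleC uea_lift_one scaleC_complex_def)
    moreover have "uea_map sv_plus_incl (\<alpha> *\<^sub>C 1) = \<alpha> *\<^sub>C 1"
      by (simp add: uea_map_def uea_lift_scaleC uea_lift_one lie_hom_commutator_sv_plus)
    ultimately show ?thesis
      using W_null_group(2) [OF W_null_relators(3) [of u "\<alpha> *\<^sub>C 1" 1 \<psi>]] by simp
  qed
  have "\<exists>u. t - frag_of (u, 1) \<in> W_null \<psi>" for t
  proof (induction t rule: frag_induction [OF subset_UNIV])
    case 1
    have "0 - frag_of (0, 1) \<in> W_null \<psi>"
      using W_null_relators(1) [of 0 0 1 \<psi>] by simp
    then show ?case by blast
  next
    case (2 x)
    then show ?case using pair by (cases x) blast
  next
    case (3 a b)
    then obtain u v where u: "a - frag_of (u, 1) \<in> W_null \<psi>" and v: "b - frag_of (v, 1) \<in> W_null \<psi>"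
      by blast
    have "(a - frag_of (u, 1)) - (b - frag_of (v, 1))
        + (frag_of (u - v + v, 1) - frag_of (u - v, 1) - frag_of (v, 1)) \<in> W_null \<psi>"
      using W_null_group(1) [OF W_null_group(3) [OF u v] W_null_relators(1) [of "u - v" v 1 \<psi>]] by simp
    then show ?case by (intro exI [of _ "u - v"]) (simp add: algebra_simps)
  qed
  then show ?thesis
    using assms(2) by (metis W_carrier_cases W_class_def W_coset_eqI)
qed

definition annihilator :: "(sv_plus \<Rightarrow> complex) \<Rightarrow> complex \<Rightarrow> sv uea set" where
  "annihilator \<psi> \<xi> = {u. W_class \<psi> u \<in> L_null \<psi> \<xi>}"

definition L_class ::
    "(sv_plus \<Rightarrow> complex) \<Rightarrow> complex \<Rightarrow> sv uea \<Rightarrow> (sv uea \<times> complex \<Rightarrow>\<^sub>0 int) set set" where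
  "L_class \<psi> \<xi> u = W_class \<psi> u +o L_null \<psi> \<xi>"

lemma L_generator_class: "L_generator \<psi> \<xi> = L_class \<psi> \<xi> 1"
  by (simp add: L_generator_def L_class_def W_generator_def W_class_def)

lemma L_act_class: "L_act \<psi> \<xi> u (L_class \<psi> \<xi> v) = L_class \<psi> \<xi> (u * v)"
  by (simp add: L_class_def L_act_coset W_act_class)

lemma L_carrier_classes:
  assumes "lie_hom \<psi>"
  shows "L_carrier \<psi> \<xi> = range (L_class \<psi> \<xi>)"
  using W_class_surj [OF assms] by (auto simp: L_carrier_def quotient_module_def L_class_def)

lemma annihilator_left: "v \<in> annihilator \<psi> \<xi> \<Longrightarrow> u * v \<in> annihilator \<psi> \<xi>"
  using L_null_act [of "W_class \<psi> v" \<psi> \<xi> u] by (simp add: annihilator_def W_act_class)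

text \<open>
  Cosets of \<open>L_null\<close> consist of cosets and have no subtraction of their own, so the usual criterion
  for their equality is obtained by computing with representatives in \<open>U(sv)\<close>.
\<close>

lemma L_class_eq_iff:
  assumes "lie_hom \<psi>"
  shows "L_class \<psi> \<xi> u = L_class \<psi> \<xi> v \<longleftrightarrow> u - v \<in> annihilator \<psi> \<xi>"
proof
  assume eq: "L_class \<psi> \<xi> u = L_class \<psi> \<xi> v"
  have "W_class \<psi> u = W_class \<psi> u + W_null \<psi>"
    using W_class_add [of \<psi> u 0] by (simp add: W_class_zero)
  then have "W_class \<psi> u \<in> L_class \<psi> \<xi> v"
    using set_plus_intro2 [OF W_null_in_L_null, of "W_class \<psi> u" \<psi> \<xi>] eq by (simp add: L_class_def)
  then obtain z where z: "z \<in> L_null \<psi> \<xi>" "W_class \<psi> u = W_class \<psi> v + z"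
    by (auto simp: L_class_def elt_set_plus_def)
  then obtain w where w: "z = W_class \<psi> w"
    using W_class_surj [OF assms] L_null_subset by blast
  have "W_class \<psi> (u - v) = W_class \<psi> u + W_class \<psi> (- v)"
    by (simp add: W_class_add)
  also have "\<dots> = z"
    by (simp add: z(2) w W_class_add)
  finally show "u - v \<in> annihilator \<psi> \<xi>" using z(1) by (simp add: annihilator_def)
next
  have sub: "L_class \<psi> \<xi> u \<subseteq> L_class \<psi> \<xi> v" if "u - v \<in> annihilator \<psi> \<xi>" for u v
  proof
    fix x assume "x \<in> L_class \<psi> \<xi> u"
    then obtain z where z: "z \<in> L_null \<psi> \<xi>" "x = W_class \<psi> u + z"
      by (auto simp: L_class_def elt_set_plus_def)
    have "W_class \<psi> u = W_class \<psi> v + W_class \<psi> (u - v)"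
      by (simp add: W_class_add)
    then have "x = W_class \<psi> v + (W_class \<psi> (u - v) + z)"
      by (simp add: z(2) add.assoc)
    then show "x \<in> L_class \<psi> \<xi> v"
      using L_null_add [OF _ z(1)] that
      by (simp only: L_class_def annihilator_def mem_Collect_eq set_plus_intro2)
  qed
  assume uv: "u - v \<in> annihilator \<psi> \<xi>"
  then have "v - u \<in> annihilator \<psi> \<xi>"
    using annihilator_left [OF uv, of "- 1"] by simp
  then show "L_class \<psi> \<xi> u = L_class \<psi> \<xi> v" using sub uv by blast
qed

lemma highest_weight_ideal_annihilator:
  assumes hom: "lie_hom \<psi>" and \<psi>: "\<And>x. \<psi> x = 0" and \<xi>: "\<xi> \<noteq> 0"
  shows "highest_weight_ideal (annihilator \<psi> \<xi>) \<xi>"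
proof
  show "0 \<in> annihilator \<psi> \<xi>"
    using W_null_in_L_null by (simp add: annihilator_def W_class_zero)
  show "u + v \<in> annihilator \<psi> \<xi>" if "u \<in> annihilator \<psi> \<xi>" "v \<in> annihilator \<psi> \<xi>" for u v
    using L_null_add that by (simp add: annihilator_def flip: W_class_add)
  show "u * v \<in> annihilator \<psi> \<xi>" if "v \<in> annihilator \<psi> \<xi>" for u v
    using that by (rule annihilator_left)
  show "UM 0 - \<xi> *\<^sub>C 1 \<in> annihilator \<psi> \<xi>"
  proof -
    have "W_class \<psi> (UM 0 - \<xi> *\<^sub>C 1) = W_act \<psi> (UM 0 - \<xi> *\<^sub>C 1) (W_class \<psi> 1)"
      by (simp add: W_act_class)
    then show ?thesis
      unfolding annihilator_def L_null_def using W_class_in_carrier by blast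
  qed
  have plus: "uea_of y \<in> annihilator \<psi> \<xi>" if "y \<in> sv_plus_basis" for y
  proof -
    define x where "x = Abs_sv_plus y"
    have x: "sv_plus_incl x = y"
      unfolding x_def using that by (intro Abs_sv_plus_inverse complex_vector.span_base)
    have "W_class \<psi> (uea_of y) = W_act \<psi> (uea_of (sv_plus_incl x)) (W_generator \<psi>)"
      using W_act_class [of \<psi> "uea_of y" 1] by (simp add: x W_class_def W_generator_def)
    also have "\<dots> = frag_of (1, 0) +o W_null \<psi>"
      using W_act_generator [OF hom, of x] by (simp add: \<psi>)
    also have "\<dots> = 0 +o W_null \<psi>"
      using W_null_group(2) [OF W_null_relators(2) [of 1 0 0 \<psi>]] by (intro W_coset_eqI) simp
    finally show ?thesis
      using W_null_in_L_null by (simp add: annihilator_def elt_set_plus_def)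
  qed
  show "UL n \<in> annihilator \<psi> \<xi>" "UM n \<in> annihilator \<psi> \<xi>" if "1 \<le> n" for n
    using that by (auto intro!: plus simp: sv_plus_basis_def)
  show "UY n \<in> annihilator \<psi> \<xi>" if "0 \<le> n" for n
    using that by (auto intro!: plus simp: sv_plus_basis_def)
qed (rule \<xi>)

theorem theorem5p5:
  fixes \<psi> :: "sv_plus \<Rightarrow> complex" and \<xi> :: complex
  assumes "lie_hom \<psi>" and "\<And>x. \<psi> x = 0" and "\<xi> \<noteq> 0"
  shows "whittaker_vectors \<psi> \<xi> = (\<lambda>u. L_act \<psi> \<xi> u (L_generator \<psi> \<xi>)) ` C_L0"
proof -
  interpret highest_weight_ideal "annihilator \<psi> \<xi>" \<xi>
    by (rule highest_weight_ideal_annihilator) fact+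
  have whittaker_iff: "L_class \<psi> \<xi> u \<in> whittaker_vectors \<psi> \<xi> \<longleftrightarrow>
      (\<forall>x. uea_of (sv_plus_incl x) * u \<in> annihilator \<psi> \<xi>)" for u
    by (auto simp: whittaker_vectors_def L_carrier_classes L_act_class L_class_eq_iff assms)
  have orbit: "L_act \<psi> \<xi> c (L_generator \<psi> \<xi>) = L_class \<psi> \<xi> c" for c
    by (simp add: L_generator_class L_act_class)
  show ?thesis
    unfolding orbit
  proof (intro equalityI subsetI)
    fix w assume w: "w \<in> whittaker_vectors \<psi> \<xi>"
    then obtain u where u: "w = L_class \<psi> \<xi> u"
      using assms(1) by (auto simp: whittaker_vectors_def L_carrier_classes)
    have "uea_of y * u \<in> annihilator \<psi> \<xi>" if "y \<in> sv_plus_basis" for y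
      using w that whittaker_iff [of u] Abs_sv_plus_inverse [OF complex_vector.span_base [OF that]]
      by (metis u)
    then have "\<exists>c\<in>C_L0. u - c \<in> annihilator \<psi> \<xi>"
      by (intro singular_in_C_L0) (auto simp: sv_plus_basis_def)
    then obtain c where "c \<in> C_L0" "u - c \<in> annihilator \<psi> \<xi>" by blast
    then show "w \<in> L_class \<psi> \<xi> ` C_L0"
      using u assms(1) by (auto simp: L_class_eq_iff)
  next
    fix w assume "w \<in> L_class \<psi> \<xi> ` C_L0"
    then show "w \<in> whittaker_vectors \<psi> \<xi>"
      using C_L0_singular whittaker_iff by auto
  qed
qed

end
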